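(* Let $T$ be a rooted tree. The map $\mathcal{O}\mapsto\tau(\mathcal{O})$ is a bijection between the orbits of rowmotion on antichains of $T$ and the possible $\mathcal{I}(T)$-tilings.
   Context: A rooted tree $T$ is a finite poset whose Hasse diagram is a tree in the graph-theoretic sense and which has a unique minimal element $\hat 0$ (the root). Let $\mathcal{A}(T)$ be the set of antichains of $T$. For $Q\subseteq T$ let $Q{\downarrow}=\{x\in T: x\le y\text{ for some }y\in Q\}$. Rowmotion on antichains is the bijection $\rho:\mathcal{A}(T)\to\mathcal{A}(T)$, $\rho(A)=\min\{x\in T: x\notin A{\downarrow}\}$ (the set of minimal elements of the complement of $A{\downarrow}$); orbits are those of the cyclic group generated by $\rho$. Intervals and branches: fix an embedding of the Hasse diagram of $T$ in the plane and label the leaves (maximal elements) $1,2,\dots,n$ from left to right. Write $[a,b]=\{a,a+1,\dots,b\}$. For each $x\in T$, the set of labels of leaves $z\ge x$ is an interval $I\subseteq[1,n]$, called the interval of $x$. The branch $B_I$ is the set of all $x\in T$ with interval $I$ (it is a chain), and $\beta_I=\#B_I$. Let $\mathcal{I}(T)=\{(I,\beta_I): I\text{ is the interval of some branch of }T\}$; write $I\in\mathcal{I}(T)$ for $(I,\beta_I)\in\mathcal{I}(T)$. All singletons $[i,i]$ are in $\mathcal{I}(T)$, and any two intervals in $\mathcal{I}(T)$ are nested or disjoint. A partition of an interval $J$ is a collection of nonempty subintervals whose disjoint union is $J$; it is an $\mathcal{I}(T)$-partition if all these subintervals are in $\mathcal{I}(T)$. Partitions are ordered by refinement, so the maximal $\mathcal{I}(T)$-partition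 of $J$ is the coarsest one; the maximal proper $\mathcal{I}(T)$-partition of $I\in\mathcal{I}(T)$ with $\#I\ge2$ is the coarsest one different from $\{I\}$. Tilings: consider a cylinder made of boxes with rows $1,\dots,n$ and some number of columns, the columns being ordered cyclically from left to right, with no distinguished first column. An $\mathcal{I}(T)$-tiling is a tiling of such a cylinder by black tiles of shape $I\times\beta_I$ with $I\in\mathcal{I}(T)$ (covering the rows in $I$ in $\beta_I$ consecutive columns), and yellow tiles of shape $I\times1$ with $\#I=1$, satisfying the following two properties: (t1) an $I\times\beta_I$ black tile is followed by a yellow tile if $\#I=1$, or by black tiles corresponding to the intervals in the maximal proper $\mathcal{I}(T)$-partition of $I$ if $\#I\ge2$; (t2) if $J$ is a maximal interval of yellow tiles in a column, then they are followed by black tiles corresponding to the intervals in the maximal $\mathcal{I}(T)$-partition of $J$. Here "followed" means in the same rows, with the new tiles beginning in the column immediately after. The map $\tau$: given an orbit $\mathcal{O}$, to each $A\in\mathcal{O}$ associate a column of $n$ boxes: for each $x\in A$ with interval $I$, the boxes in the rows of $I$ are covered by a black tile; every other box is covered by a single yellow tile. Paste the columns of all antichains in the orbit together, in the (cyclic) order in which they appear in the orbit, onto a cylinder with $\#\mathcal{O}$ columns, combining into one tile black tiles in consecutive columns coming from the same interval $I$. The result is $\tau(\mathcal{O})$.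
   Formalization: The tilings are restricted to primitive ones (fixed by no nontrivial rotation of the cylinder), since repeating a tiling around a longer cylinder gives another tiling and the claim would fail, e.g. for a one-point tree. *)

theory Defs
  imports "HOL-Library.Disjoint_Sets" "HOL-Combinatorics.Orbits"
begin

section \<open>Rooted trees\<close>

text \<open>
  A finite poset is a finite subset \<open>T\<close> of a type of class \<open>order\<close>, with the
  restricted order. Every finite poset arises in this way up to isomorphism, for instance
  as a family of finite sets of natural numbers ordered by inclusion.
\<close>

definition covers :: "'a::order set \<Rightarrow> 'a \<Rightarrow> 'a \<Rightarrow> bool" where
  "covers T x y \<longleftrightarrow> x \<in> T \<and> y \<in> T \<and> x < y \<and> \<not> (\<exists>z\<in>T. x < z \<and> z < y)"

definition hasse :: "'a::order set \<Rightarrow> 'a rel" where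
  "hasse T = {(x, y). covers T x y \<or> covers T y x}"

text \<open>
  Trees as undirected simple graphs, given by a symmetric irreflexive edge relation: connected
  and without cycles of length at least 3. (For directed graphs in which every edge is present
  in both directions, two-element closed walks have to be excluded as cycles.)
\<close>

definition graph_cycle :: "'a rel \<Rightarrow> 'a list \<Rightarrow> bool" where
  "graph_cycle E vs \<longleftrightarrow> distinct vs \<and> 3 \<le> length vs \<and>
     (\<forall>i<length vs. (vs ! i, vs ! (Suc i mod length vs)) \<in> E)"

definition graph_tree :: "'a set \<Rightarrow> 'a rel \<Rightarrow> bool" where
  "graph_tree V E \<longleftrightarrow> V \<noteq> {} \<and> (\<forall>x\<in>V. \<forall>y\<in>V. (x, y) \<in> E\<^sup>*) \<and> \<not> (\<exists>vs. graph_cycle E vs)"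

definition min_elems :: "'a::order set \<Rightarrow> 'a set" where
  "min_elems X = {x \<in> X. \<not> (\<exists>y\<in>X. y < x)}"

definition leaves :: "'a::order set \<Rightarrow> 'a set" where
  "leaves T = {x \<in> T. \<not> (\<exists>y\<in>T. x < y)}"

definition rooted_tree :: "'a::order set \<Rightarrow> bool" where
  "rooted_tree T \<longleftrightarrow> finite T \<and> graph_tree T (hasse T) \<and> (\<exists>!r. r \<in> min_elems T)"


section \<open>Rowmotion on antichains\<close>

definition antichains :: "'a::order set \<Rightarrow> 'a set set" where
  "antichains T = {A. A \<subseteq> T \<and> (\<forall>x\<in>A. \<forall>y\<in>A. \<not> x < y)}"

definition down :: "'a::order set \<Rightarrow> 'a set \<Rightarrow> 'a set" where
  "down T Q = {x \<in> T. \<exists>y\<in>Q. x \<le> y}"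

definition rowmotion :: "'a::order set \<Rightarrow> 'a set \<Rightarrow> 'a set" where
  "rowmotion T A = min_elems {x \<in> T. x \<notin> down T A}"

text \<open>
  Rowmotion permutes the finite set of antichains, so the forward orbit
  \<^term>\<open>orbit (rowmotion T) A\<close>, consisting of all iterates with positive exponent, is the orbit
  of \<open>A\<close> under the cyclic group generated by rowmotion.
\<close>

definition rowmotion_orbits :: "'a::order set \<Rightarrow> 'a set set set" where
  "rowmotion_orbits T = (\<lambda>A. orbit (rowmotion T) A) ` antichains T"


section \<open>Plane embeddings, intervals and branches\<close>

text \<open>
  An embedding of the Hasse diagram in the plane, drawn upwards from the root, is given
  combinatorially: \<open>ch x\<close> lists the children (upper covers) of \<open>x\<close> from left to right.
\<close>

definition plane_embedding :: "'a::order set \<Rightarrow> ('a \<Rightarrow> 'a list) \<Rightarrow> bool" where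
  "plane_embedding T ch \<longleftrightarrow> (\<forall>x\<in>T. distinct (ch x) \<and> set (ch x) = {y. covers T x y})"

text \<open>
  \<open>a\<close> is to the left of \<open>b\<close> if, at some vertex, \<open>a\<close> belongs to the subtree of a child further
  to the left than the one whose subtree contains \<open>b\<close>.
\<close>

definition left_of :: "'a::order set \<Rightarrow> ('a \<Rightarrow> 'a list) \<Rightarrow> 'a \<Rightarrow> 'a \<Rightarrow> bool" where
  "left_of T ch a b \<longleftrightarrow>
     (\<exists>x\<in>T. \<exists>i j. i < j \<and> j < length (ch x) \<and> ch x ! i \<le> a \<and> ch x ! j \<le> b)"

definition label :: "'a::order set \<Rightarrow> ('a \<Rightarrow> 'a list) \<Rightarrow> 'a \<Rightarrow> nat" where
  "label T ch z = Suc (card {y \<in> leaves T. left_of T ch y z})"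

definition interval_of :: "'a::order set \<Rightarrow> ('a \<Rightarrow> 'a list) \<Rightarrow> 'a \<Rightarrow> nat set" where
  "interval_of T ch x = label T ch ` {z \<in> leaves T. x \<le> z}"

definition branch :: "'a::order set \<Rightarrow> ('a \<Rightarrow> 'a list) \<Rightarrow> nat set \<Rightarrow> 'a set" where
  "branch T ch I = {x \<in> T. interval_of T ch x = I}"

definition tree_intervals :: "'a::order set \<Rightarrow> ('a \<Rightarrow> 'a list) \<Rightarrow> (nat set \<times> nat) set" where
  "tree_intervals T ch = {(I, card (branch T ch I)) | I. I \<in> interval_of T ch ` T}"


section \<open>Interval partitions\<close>

text \<open>
  From here on \<open>\<I>\<close> is a set of pairs \<open>(I, \<beta>)\<close> as produced by \<^const>\<open>tree_intervals\<close>;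
  \<^term>\<open>Domain \<I>\<close> is the set of its intervals.
\<close>

definition interval_partition_on :: "(nat set \<times> nat) set \<Rightarrow> nat set \<Rightarrow> nat set set \<Rightarrow> bool" where
  "interval_partition_on \<I> J P \<longleftrightarrow>
     partition_on J P \<and> (\<forall>K\<in>P. \<exists>a b. K = {a..b}) \<and> P \<subseteq> Domain \<I>"

definition maximal_partition :: "(nat set \<times> nat) set \<Rightarrow> nat set \<Rightarrow> nat set set \<Rightarrow> bool" where
  "maximal_partition \<I> J P \<longleftrightarrow>
     interval_partition_on \<I> J P \<and> (\<forall>Q. interval_partition_on \<I> J Q \<longrightarrow> refines J Q P)"

definition maximal_proper_partition ::
    "(nat set \<times> nat) set \<Rightarrow> nat set \<Rightarrow> nat set set \<Rightarrow> bool" where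
  "maximal_proper_partition \<I> I P \<longleftrightarrow>
     interval_partition_on \<I> I P \<and> P \<noteq> {I} \<and>
     (\<forall>Q. interval_partition_on \<I> I Q \<and> Q \<noteq> {I} \<longrightarrow> refines I Q P)"

definition maximal_interval_in :: "nat set \<Rightarrow> nat set \<Rightarrow> bool" where
  "maximal_interval_in J Y \<longleftrightarrow> J \<noteq> {} \<and> (\<exists>a b. J = {a..b}) \<and> J \<subseteq> Y \<and>
     (\<forall>a b. J \<subseteq> {a..b} \<and> {a..b} \<subseteq> Y \<longrightarrow> {a..b} = J)"


section \<open>Tilings of cylinders\<close>

text \<open>
  The columns of a cylinder with \<open>N\<close> columns are the residues \<open>0, \<dots>, N - 1\<close> modulo \<open>N\<close>.
  A tile covers the given rows in \<open>width\<close> consecutive columns, the first of which is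
  \<open>start\<close>. A tiled cylinder is a pair of its number of columns and its set of tiles.
\<close>

datatype colour = Black | Yellow

datatype tile = Tile (colour: colour) (rows: "nat set") (start: nat) (width: nat)

type_synonym cylinder = "nat \<times> tile set"

definition tile_covers :: "nat \<Rightarrow> tile \<Rightarrow> nat \<Rightarrow> nat \<Rightarrow> bool" where
  "tile_covers N t r c \<longleftrightarrow> r \<in> rows t \<and> (\<exists>j<width t. c = (start t + j) mod N)"

text \<open>The condition \<open>width t \<le> N\<close> says that a tile does not wrap around onto itself.\<close>

definition cylinder_tiling :: "nat \<Rightarrow> cylinder \<Rightarrow> bool" where
  "cylinder_tiling n = (\<lambda>(N, S). 0 < N \<and>
     (\<forall>t\<in>S. rows t \<subseteq> {1..n} \<and> start t < N \<and> width t \<le> N) \<and>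
     (\<forall>r\<in>{1..n}. \<forall>c<N. \<exists>!t. t \<in> S \<and> tile_covers N t r c))"

definition tile_shapes :: "(nat set \<times> nat) set \<Rightarrow> cylinder \<Rightarrow> bool" where
  "tile_shapes \<I> = (\<lambda>(N, S). \<forall>t\<in>S.
     (case colour t of
        Black \<Rightarrow> (rows t, width t) \<in> \<I>
      | Yellow \<Rightarrow> (rows t, width t) \<in> {(I, 1) | I. I \<in> Domain \<I> \<and> card I = 1}))"

definition black_tiles_at :: "tile set \<Rightarrow> nat set set \<Rightarrow> nat \<Rightarrow> bool" where
  "black_tiles_at S P c \<longleftrightarrow> (\<forall>K\<in>P. \<exists>w. Tile Black K c w \<in> S)"

definition tiling_t1 :: "(nat set \<times> nat) set \<Rightarrow> cylinder \<Rightarrow> bool" where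
  "tiling_t1 \<I> = (\<lambda>(N, S). \<forall>I s w. Tile Black I s w \<in> S \<longrightarrow>
     (if card I = 1 then Tile Yellow I ((s + w) mod N) 1 \<in> S
      else \<exists>P. maximal_proper_partition \<I> I P \<and> black_tiles_at S P ((s + w) mod N)))"

definition yellow_rows :: "tile set \<Rightarrow> nat \<Rightarrow> nat set" where
  "yellow_rows S c = {r. Tile Yellow {r} c 1 \<in> S}"

definition tiling_t2 :: "(nat set \<times> nat) set \<Rightarrow> cylinder \<Rightarrow> bool" where
  "tiling_t2 \<I> = (\<lambda>(N, S). \<forall>c<N. \<forall>J. maximal_interval_in J (yellow_rows S c) \<longrightarrow>
     (\<exists>P. maximal_partition \<I> J P \<and> black_tiles_at S P (Suc c mod N)))"

definition interval_tiling :: "nat \<Rightarrow> (nat set \<times> nat) set \<Rightarrow> cylinder \<Rightarrow> bool" where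
  "interval_tiling n \<I> C \<longleftrightarrow>
     cylinder_tiling n C \<and> tile_shapes \<I> C \<and> tiling_t1 \<I> C \<and> tiling_t2 \<I> C"

text \<open>
  Since a cylinder has no distinguished first column, tilings are considered up to rotation.
\<close>

definition shift :: "nat \<Rightarrow> cylinder \<Rightarrow> cylinder" where
  "shift k = (\<lambda>(N, S). (N, (\<lambda>t. Tile (colour t) (rows t) ((start t + k) mod N) (width t)) ` S))"

definition rotation_rel :: "cylinder rel" where
  "rotation_rel = {(C, D). \<exists>k. D = shift k C}"

text \<open>
  Concatenating several copies of an interval tiling gives another one, on a longer cylinder,
  that describes the same periodic pattern. For instance, if \<open>T\<close> is a single point, the cylinder
  with one black and one yellow box and the one with columns black, yellow, black, yellow are
  both interval tilings, whereas \<open>T\<close> has one orbit only. Tilings are therefore taken to be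
  primitive, i.e.\ not invariant under any nontrivial rotation.
\<close>

definition primitive :: "cylinder \<Rightarrow> bool" where
  "primitive C \<longleftrightarrow> (\<forall>k. 0 < k \<and> k < fst C \<longrightarrow> shift k C \<noteq> C)"

definition interval_tilings :: "nat \<Rightarrow> (nat set \<times> nat) set \<Rightarrow> cylinder set set" where
  "interval_tilings n \<I> = {C. interval_tiling n \<I> C \<and> primitive C} // rotation_rel"


section \<open>The tiling of an orbit\<close>

definition black_intervals :: "'a::order set \<Rightarrow> ('a \<Rightarrow> 'a list) \<Rightarrow> 'a set \<Rightarrow> nat set set" where
  "black_intervals T ch A = interval_of T ch ` A"

text \<open>
  The tiled cylinder of the orbit of \<open>A\<close>, with column 0 given by \<open>A\<close>. A black tile is a maximal
  run of consecutive columns containing the same interval. As the iterates of rowmotion on \<open>A\<close>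
  are periodic with period \<open>N\<close>, column indices below need not be reduced modulo \<open>N\<close>, and
  \<open>s + N - 1\<close> is the column before \<open>s\<close>. No interval occurs in all columns of an orbit, so
  no run goes all the way around the cylinder.
\<close>

definition orbit_cylinder :: "'a::order set \<Rightarrow> ('a \<Rightarrow> 'a list) \<Rightarrow> 'a set \<Rightarrow> cylinder" where
  "orbit_cylinder T ch A =
     (let N = card (orbit (rowmotion T) A);
          B = (\<lambda>c. black_intervals T ch ((rowmotion T ^^ c) A))
      in (N,
          {Tile Black I s w | I s w. s < N \<and> 0 < w \<and>
             (\<forall>j<w. I \<in> B (s + j)) \<and> I \<notin> B (s + N - 1) \<and> I \<notin> B (s + w)} \<union>
          {Tile Yellow {r} s 1 | r s. s < N \<and> r \<in> {1..card (leaves T)} \<and> r \<notin> \<Union> (B s)}))"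

text \<open>
  As a tiling up to rotation, \<open>\<tau>(\<O>)\<close> is the set of the cylinders obtained from all choices of the
  first column.
\<close>

definition tau :: "'a::order set \<Rightarrow> ('a \<Rightarrow> 'a list) \<Rightarrow> 'a set set \<Rightarrow> cylinder set" where
  "tau T ch \<O> = orbit_cylinder T ch ` \<O>"

end

theory Submission
  imports Defs
begin

text \<open>
  A rowmotion orbit can be drawn because of how an element moves. If \<open>x\<close> lies in the antichain \<open>A\<close>,
  every upper cover \<open>c\<close> of \<open>x\<close> lies in \<open>\<rho> A\<close>: nothing above \<open>x\<close> is in the down-set of \<open>A\<close>, and in
  a tree everything strictly below \<open>c\<close> is below \<open>x\<close>. So a black region climbs its branch one element
  per column, and at the top of the branch it splits into the branches of the children; that is (t1).
  The other elements of \<open>\<rho> A\<close> are comparable to no element of \<open>A\<close>. Their intervals consist of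
  uncovered rows, and since the elements are minimal, these intervals are the largest tree intervals
  that fit between the covered rows; that is (t2).

  Both rules determine a column from the preceding one, and this makes the correspondence
  bijective. A box of a tiling knows its black tile and its offset in this tile, that is, its branch
  and its position on the branch. Hence a column of a tiling can be read as an antichain
  (\<open>column_antichain\<close>), and comparing the two rules with the description of rowmotion row by
  row (\<open>row_step\<close>) shows that rowmotion moves each column to the next one (\<open>column_Suc\<close>). So the
  tilings of a cylinder with \<open>N\<close> columns are exactly the pictures \<open>tiles N A\<close> of antichains \<open>A\<close> with
  \<open>\<rho>\<^sup>N A = A\<close> (\<open>periodic_tiling\<close>, \<open>tiling_is_periodic\<close>), the picture determines \<open>A\<close>
  (\<open>tiles_inj\<close>), rotating the cylinder changes \<open>A\<close> along its orbit (\<open>shift_tiles\<close>), and the tiling is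
  primitive precisely when \<open>N\<close> is the size of the orbit (\<open>primitive_iff\<close>). Finally, \<open>\<tau>\<close> takes maximal
  runs of equal intervals as black tiles, whereas \<open>tiles\<close> starts a tile of the full branch length at
  each bottom element of a branch; these agree since a run enters a branch only at its bottom and
  leaves it only at its top (\<open>orbit_cylinder_tiles\<close>).

  Two preliminary facts about trees carry the geometry: elements with a common upper bound are
  comparable, so that intersecting intervals belong to comparable elements, and the leaves above an
  element are consecutive in the left-to-right order, so that intervals are indeed intervals.
\<close>

section \<open>Rooted trees as posets\<close>

lemma graph_cycleI:
  assumes "distinct vs" "3 \<le> length vs" "successively (\<lambda>a b. (a, b) \<in> E) vs"
    "(last vs, hd vs) \<in> E"
  shows "graph_cycle E vs"
  unfolding graph_cycle_def
proof (intro conjI allI impI)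
  fix i assume i: "i < length vs"
  have ne: "vs \<noteq> []" using assms(2) by auto
  show "(vs ! i, vs ! (Suc i mod length vs)) \<in> E"
  proof (cases "Suc i < length vs")
    case True
    then have "successively (\<lambda>a b. (a, b) \<in> E) (drop i vs)"
      using assms(3) by (metis append_take_drop_id successively_append_iff)
    moreover have "drop i vs = vs ! i # vs ! Suc i # drop (Suc (Suc i)) vs"
      using True by (simp add: Cons_nth_drop_Suc)
    ultimately show ?thesis using True by simp
  next
    case False
    then have "i = length vs - 1" "Suc i = length vs" using i by auto
    then show ?thesis using assms(4) ne by (simp add: last_conv_nth hd_conv_nth)
  qed
qed (use assms in auto)

text \<open>
  Saturated chains are paths in the Hasse diagram; two of them are glued to a cycle below.
\<close>

lemma saturated_chain:
  fixes T :: "'a::order set"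
  assumes "finite T" "x \<in> T" "y \<in> T" "x < y"
  obtains p where "p \<noteq> []" "last p = y" "successively (covers T) (x # p)" "distinct p"
    "set p \<subseteq> {w. x < w \<and> w \<le> y}"
proof -
  have "\<exists>p. p \<noteq> [] \<and> last p = y \<and> successively (covers T) (x # p) \<and> distinct p
      \<and> set p \<subseteq> {w. x < w \<and> w \<le> y}"
    using assms(2,4)
  proof (induction "card {w \<in> T. x < w \<and> w \<le> y}" arbitrary: x rule: less_induct)
    case less
    let ?U = "{w \<in> T. x < w \<and> w \<le> y}"
    have "finite ?U" "y \<in> ?U" using assms less.prems by auto
    then obtain w where w: "w \<in> ?U" "\<forall>v\<in>?U. v \<le> w \<longrightarrow> v = w"
      using finite_has_minimal[of ?U] by blast
    have cov: "covers T x w"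
      using w less.prems unfolding covers_def by auto
    show ?case
    proof (cases "w = y")
      case True
      then show ?thesis using cov less.prems by (intro exI[of _ "[y]"]) auto
    next
      case False
      then have wy: "w < y" using w by auto
      have "{v \<in> T. w < v \<and> v \<le> y} \<subset> ?U"
        using w by (auto intro: less_trans)
      then have "card {v \<in> T. w < v \<and> v \<le> y} < card ?U"
        using \<open>finite ?U\<close> by (rule psubset_card_mono[rotated])
      from less.hyps[OF this] w wy obtain p where "p \<noteq> []" "last p = y"
        "successively (covers T) (w # p)" "distinct p" "set p \<subseteq> {v. w < v \<and> v \<le> y}" by auto
      then show ?thesis using cov w wy by (intro exI[of _ "w # p"]) (auto intro: less_trans)
    qed
  qed
  then show ?thesis using that by metis
qed

text \<open>
  Choose a maximal common lower bound \<open>z\<close> of the two lower covers \<open>y1\<close> and \<open>y2\<close>. By maximality,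
  saturated chains from \<open>z\<close> to \<open>y1\<close> and from \<open>z\<close> to \<open>y2\<close> meet in \<open>z\<close> only, and together with
  \<open>x\<close> they close up to a cycle.
\<close>

lemma hasse_cycle_of_two_lower_covers:
  fixes T :: "'a::order set"
  assumes "finite T" "covers T y1 x" "covers T y2 x" "y1 \<noteq> y2"
    and "r \<in> T" "r \<le> y1" "r \<le> y2"
  shows "\<exists>vs. graph_cycle (hasse T) vs"
proof -
  let ?Z = "{z \<in> T. z \<le> y1 \<and> z \<le> y2}"
  have "finite ?Z" "r \<in> ?Z" using assms by auto
  then obtain z where z: "z \<in> ?Z" and zmax: "\<forall>v\<in>?Z. z \<le> v \<longrightarrow> v = z"
    using finite_has_maximal[of ?Z] by blast
  have yx: "y1 \<in> T" "y2 \<in> T" "y1 < x" "y2 < x" using assms(2,3) by (auto simp: covers_def)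
  have "\<not> y1 \<le> y2" "\<not> y2 \<le> y1" using assms(2,3,4) yx unfolding covers_def by (auto simp: order_less_le)
  then have lt: "z < y1" "z < y2" using z by (auto simp: order_less_le)
  obtain p where p: "p \<noteq> []" "last p = y1" "successively (covers T) (z # p)" "distinct p"
    "set p \<subseteq> {w. z < w \<and> w \<le> y1}" using saturated_chain[OF assms(1) _ yx(1) lt(1)] z by auto
  obtain q where q: "q \<noteq> []" "last q = y2" "successively (covers T) (z # q)" "distinct q"
    "set q \<subseteq> {w. z < w \<and> w \<le> y2}" using saturated_chain[OF assms(1) _ yx(2) lt(2)] z by auto
  have qT: "set q \<subseteq> T"
  proof -
    have "successively (covers T) (z # q) \<Longrightarrow> set q \<subseteq> T" for z q
      by (induction q arbitrary: z) (auto simp: covers_def)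
    then show ?thesis using q by blast
  qed
  have disj: "set p \<inter> set q = {}"
    using p(5) q(5) qT zmax by fastforce
  have xnot: "x \<notin> set p" "x \<notin> set q" "x \<noteq> z"
    using p(5) q(5) yx lt by (auto dest: subsetD)
  have sp: "successively (\<lambda>a b. (a, b) \<in> hasse T) (z # p)"
    by (rule successively_mono[OF p(3)]) (auto simp: hasse_def)
  have sq: "successively (\<lambda>a b. (b, a) \<in> hasse T) (z # q)"
    by (rule successively_mono[OF q(3)]) (auto simp: hasse_def)
  have "graph_cycle (hasse T) (z # p @ x # rev q)"
  proof (rule graph_cycleI)
    show "distinct (z # p @ x # rev q)"
      using p q disj xnot by auto
    show "3 \<le> length (z # p @ x # rev q)"
      using p(1) q(1) by (cases p; cases q) auto
    have e: "(y1, x) \<in> hasse T" "(x, y2) \<in> hasse T" using assms(2,3) by (auto simp: hasse_def)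
    have "successively (\<lambda>a b. (a, b) \<in> hasse T) (rev q)"
      using sq q(1) by (simp add: successively_Cons)
    then show "successively (\<lambda>a b. (a, b) \<in> hasse T) (z # p @ x # rev q)"
      using sp e p q by (auto simp: successively_append_iff successively_Cons hd_rev)
    show "(last (z # p @ x # rev q), hd (z # p @ x # rev q)) \<in> hasse T"
      using sq q(1) by (simp add: successively_Cons last_rev)
  qed
  then show ?thesis by blast
qed

locale plane_tree =
  fixes T :: "'a::order set" and ch :: "'a \<Rightarrow> 'a list"
  assumes rooted_tree: "rooted_tree T" and plane_embedding: "plane_embedding T ch"
begin

lemma finite_T: "finite T" using rooted_tree by (simp add: rooted_tree_def)

lemma min_below:
  assumes "X \<subseteq> T" "x \<in> X"
  obtains m where "m \<in> min_elems X" "m \<le> x"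
proof -
  have "finite X" using assms finite_T finite_subset by blast
  then obtain m where m: "m \<in> X" "m \<le> x" "\<forall>b\<in>X. b \<le> m \<longrightarrow> m = b"
    using finite_has_minimal2[of X x] assms by blast
  have "\<not> y < m" if "y \<in> X" for y
    using m(3) that by (auto simp: order_less_le)
  then have "m \<in> min_elems X" using m(1) unfolding min_elems_def by simp
  then show ?thesis using \<open>m \<le> x\<close> that by blast
qed

lemma ex_root: "\<exists>r\<in>T. \<forall>x\<in>T. r \<le> x"
proof -
  obtain r where r: "r \<in> min_elems T" "\<And>s. s \<in> min_elems T \<Longrightarrow> s = r"
    using rooted_tree by (auto simp: rooted_tree_def)
  have "r \<le> x" if "x \<in> T" for x
    using min_below[of T x] that r by blast
  moreover have "r \<in> T" using r(1) by (simp add: min_elems_def)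
  ultimately show ?thesis by blast
qed

lemma unique_lower_cover:
  assumes "covers T y1 x" "covers T y2 x"
  shows "y1 = y2"
proof (rule ccontr)
  assume neq: "y1 \<noteq> y2"
  obtain r where r: "r \<in> T" "\<forall>x\<in>T. r \<le> x" using ex_root by blast
  have "y1 \<in> T" "y2 \<in> T" using assms by (auto simp: covers_def)
  then have "\<exists>vs. graph_cycle (hasse T) vs"
    using hasse_cycle_of_two_lower_covers[OF finite_T assms neq r(1)] r(2) by simp
  then show False using rooted_tree by (simp add: rooted_tree_def graph_tree_def)
qed

lemma ex_lower_cover:
  assumes "y \<in> T" "x \<in> T" "y < x"
  obtains p where "covers T p x" "y \<le> p"
proof -
  let ?X = "{z \<in> T. y \<le> z \<and> z < x}"
  have "finite ?X" "y \<in> ?X" using finite_T assms by auto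
  then obtain p where "p \<in> ?X" "\<forall>z\<in>?X. p \<le> z \<longrightarrow> z = p"
    using finite_has_maximal[of ?X] by blast
  then have "covers T p x" "y \<le> p" using assms unfolding covers_def by auto
  then show ?thesis by (rule that)
qed

lemma ex_upper_cover:
  assumes "y \<in> T" "x \<in> T" "y < x"
  obtains c where "covers T y c" "c \<le> x"
proof -
  let ?X = "{z \<in> T. y < z \<and> z \<le> x}"
  have "finite ?X" "x \<in> ?X" using finite_T assms by auto
  then obtain c where "c \<in> ?X" "\<forall>z\<in>?X. z \<le> c \<longrightarrow> z = c"
    using finite_has_minimal[of ?X] by blast
  then have "covers T y c" "c \<le> x" using assms unfolding covers_def by auto
  then show ?thesis by (rule that)
qed

lemma below_cover: "covers T p x \<Longrightarrow> y \<in> T \<Longrightarrow> y < x \<Longrightarrow> y \<le> p"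
  using ex_lower_cover[of y x] unique_lower_cover[of p x] unfolding covers_def by metis

text \<open>
  Lower covers are unique, so all elements below \<open>z\<close> lie on the one path that descends from \<open>z\<close>.
\<close>

lemma below_comparable:
  assumes "x \<in> T" "y \<in> T" "z \<in> T" "x \<le> z" "y \<le> z"
  shows "x \<le> y \<or> y \<le> x"
  using assms(3-5)
proof (induction "card {w \<in> T. w < z}" arbitrary: z rule: less_induct)
  case less
  show ?case
  proof (cases "x = z \<or> y = z")
    case True
    then show ?thesis using less by auto
  next
    case False
    then have lt: "x < z" "y < z" using less by auto
    obtain p where p: "covers T p z" "x \<le> p" using ex_lower_cover assms less lt by metis
    have "y \<le> p" using below_cover p lt assms by blast
    moreover have "{w \<in> T. w < p} \<subset> {w \<in> T. w < z}"
      using p by (auto simp: covers_def intro: less_trans)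
    then have "card {w \<in> T. w < p} < card {w \<in> T. w < z}"
      using finite_T by (intro psubset_card_mono) auto
    ultimately show ?thesis using less.hyps[of p] p by (auto simp: covers_def)
  qed
qed

lemma leaf_above:
  assumes "x \<in> T"
  obtains z where "z \<in> leaves T" "x \<le> z"
proof -
  obtain z where "z \<in> T" "x \<le> z" "\<forall>b\<in>T. z \<le> b \<longrightarrow> z = b"
    using finite_has_maximal2[OF finite_T assms] by metis
  then have "z \<in> leaves T" by (auto simp: leaves_def order_less_le)
  then show ?thesis using \<open>x \<le> z\<close> that by blast
qed

lemma leaf_le: "z \<in> leaves T \<Longrightarrow> y \<in> T \<Longrightarrow> z \<le> y \<Longrightarrow> y = z"
  by (auto simp: leaves_def order_less_le)

end

section \<open>Labels and intervals\<close>

text \<open>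
  Counting predecessors in a finite strict linear order is a numbering. The order is an arbitrary
  relation \<open>R\<close>, since this is used both for the left-to-right order of the leaves and for the order
  within a branch.
\<close>

lemma rank_bij:
  fixes S :: "'b set"
  assumes fin: "finite S"
    and irrefl: "\<And>x. x \<in> S \<Longrightarrow> \<not> R x x"
    and trans: "\<And>x y z. x \<in> S \<Longrightarrow> y \<in> S \<Longrightarrow> z \<in> S \<Longrightarrow> R x y \<Longrightarrow> R y z \<Longrightarrow> R x z"
    and total: "\<And>x y. x \<in> S \<Longrightarrow> y \<in> S \<Longrightarrow> x \<noteq> y \<Longrightarrow> R x y \<or> R y x"
  shows "bij_betw (\<lambda>z. card {y \<in> S. R y z}) S {..<card S}"
    and "x \<in> S \<Longrightarrow> y \<in> S \<Longrightarrow> card {w \<in> S. R w x} < card {w \<in> S. R w y} \<longleftrightarrow> R x y"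
proof -
  let ?r = "\<lambda>z. card {y \<in> S. R y z}"
  have mono: "?r x < ?r y" if "x \<in> S" "y \<in> S" "R x y" for x y
  proof (rule psubset_card_mono)
    show "{w \<in> S. R w x} \<subset> {w \<in> S. R w y}"
      using that irrefl[of x] trans[of _ x y] by blast
  qed (use fin in auto)
  have inj: "inj_on ?r S"
  proof (rule inj_onI, rule ccontr)
    fix x y assume "x \<in> S" "y \<in> S" "?r x = ?r y" "x \<noteq> y"
    then show False using total[of x y] mono[of x y] mono[of y x] by auto
  qed
  have "?r z < card S" if "z \<in> S" for z
  proof (rule psubset_card_mono)
    show "{y \<in> S. R y z} \<subset> S" using that irrefl[of z] by blast
  qed (rule fin)
  then have "?r ` S \<subseteq> {..<card S}" by auto
  then have "?r ` S = {..<card S}"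
    using inj by (intro card_subset_eq) (auto simp: card_image)
  then show "bij_betw ?r S {..<card S}" using inj by (simp add: bij_betw_def)
  show "?r x < ?r y \<longleftrightarrow> R x y" if "x \<in> S" "y \<in> S"
  proof
    assume less: "?r x < ?r y"
    then have "x \<noteq> y" by auto
    moreover have "\<not> R y x" using mono[OF that(2,1)] less by linarith
    ultimately show "R x y" using total[OF that] by blast
  qed (rule mono[OF that])
qed

lemma nat_interval_if_convex:
  fixes I :: "nat set"
  assumes "finite I" "I \<noteq> {}" "\<And>i j k. i \<in> I \<Longrightarrow> k \<in> I \<Longrightarrow> i < j \<Longrightarrow> j < k \<Longrightarrow> j \<in> I"
  shows "\<exists>a b. I = {a..b}"
proof -
  have "j \<in> I" if "j \<in> {Min I..Max I}" for j
  proof (cases "j = Min I \<or> j = Max I")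
    case True
    then show ?thesis using Min_in[OF assms(1,2)] Max_in[OF assms(1,2)] by auto
  next
    case False
    then have "Min I < j" "j < Max I" using that by auto
    then show ?thesis using assms(3)[OF Min_in[OF assms(1,2)] Max_in[OF assms(1,2)]] by blast
  qed
  moreover have "j \<in> {Min I..Max I}" if "j \<in> I" for j using that assms(1) by simp
  ultimately have "I = {Min I..Max I}" by blast
  then show ?thesis by blast
qed

context plane_tree
begin

lemma child_below:
  assumes "covers T x c" "c \<le> a" "x < y" "y \<le> a" "y \<in> T" "a \<in> T"
  shows "c \<le> y"
  using below_comparable[of c y a] assms by (auto simp: covers_def order_less_le)

lemma child_unique:
  assumes "covers T x c" "covers T x d" "c \<le> a" "d \<le> a" "a \<in> T"
  shows "c = d"
proof -
  have "c \<le> d" using child_below[of x c a d] assms by (auto simp: covers_def)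
  moreover have "d \<le> c" using child_below[of x d a c] assms by (auto simp: covers_def)
  ultimately show ?thesis by simp
qed

lemma covers_ch: "x \<in> T \<Longrightarrow> i < length (ch x) \<Longrightarrow> covers T x (ch x ! i)"
  using plane_embedding nth_mem[of i "ch x"] by (auto simp: plane_embedding_def)

lemma ex_ch:
  assumes "covers T x c"
  obtains i where "i < length (ch x)" "ch x ! i = c"
proof -
  have "x \<in> T" using assms by (simp add: covers_def)
  then have "c \<in> set (ch x)" using assms plane_embedding by (simp add: plane_embedding_def)
  then show ?thesis using that by (auto simp: in_set_conv_nth)
qed

lemma ch_index_unique:
  assumes "x \<in> T" "i < length (ch x)" "j < length (ch x)" "ch x ! i \<le> a" "ch x ! j \<le> a" "a \<in> T"
  shows "i = j"
proof -
  have "ch x ! i = ch x ! j"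
    using assms by (intro child_unique[OF covers_ch covers_ch])
  moreover have "distinct (ch x)" using plane_embedding assms(1) by (simp add: plane_embedding_def)
  ultimately show ?thesis using assms by (simp add: nth_eq_iff_index_eq)
qed

lemma left_of_irrefl: "a \<in> T \<Longrightarrow> \<not> left_of T ch a a"
  unfolding left_of_def by (metis ch_index_unique less_trans nat_neq_iff)

text \<open>
  Both relations are witnessed at a vertex below \<open>b\<close>, so the two vertices \<open>x\<close> and \<open>y\<close> are comparable.
  The lower one witnesses the conclusion, because the branching at the higher one takes place within
  a single child subtree of the lower one.
\<close>

lemma left_of_trans:
  assumes "a \<in> T" "b \<in> T" "c \<in> T" "left_of T ch a b" "left_of T ch b c"
  shows "left_of T ch a c"
proof -
  obtain x i j where x: "x \<in> T" "i < j" "j < length (ch x)" "ch x ! i \<le> a" "ch x ! j \<le> b"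
    using assms(4) unfolding left_of_def by blast
  obtain y k l where y: "y \<in> T" "k < l" "l < length (ch y)" "ch y ! k \<le> b" "ch y ! l \<le> c"
    using assms(5) unfolding left_of_def by blast
  have cx: "covers T x (ch x ! j)" and cy: "covers T y (ch y ! k)"
    using x y by (auto intro: covers_ch)
  have "x < b" "y < b" using cx cy x y by (auto simp: covers_def)
  then consider "x = y" | "x < y" | "y < x"
    using below_comparable[of x y b] x y assms by (auto simp: order_less_le)
  then show ?thesis
  proof cases
    case 1
    then have "j = k" using ch_index_unique[of x j k b] x y assms by simp
    then have "i < l" using x y by simp
    then show ?thesis using 1 x y unfolding left_of_def by blast
  next
    case 2
    then have "ch x ! j \<le> y" using child_below[OF cx x(5)] \<open>y < b\<close> y assms by simp
    moreover have "y \<le> c" using covers_ch[OF y(1,3)] y(5) by (auto simp: covers_def)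
    ultimately show ?thesis using x unfolding left_of_def by (meson order_trans)
  next
    case 3
    then have "ch y ! k \<le> x" using child_below[OF cy y(4)] \<open>x < b\<close> x assms by simp
    moreover have "x \<le> a" using covers_ch[of x i] x by (auto simp: covers_def)
    ultimately show ?thesis using y unfolding left_of_def by (meson order_trans)
  qed
qed

text \<open>
  Two distinct leaves separate at their greatest common lower bound.
\<close>

lemma left_of_total:
  assumes "a \<in> leaves T" "b \<in> leaves T" "a \<noteq> b"
  shows "left_of T ch a b \<or> left_of T ch b a"
proof -
  have T: "a \<in> T" "b \<in> T" using assms by (auto simp: leaves_def)
  let ?Z = "{z \<in> T. z \<le> a \<and> z \<le> b}"
  have "finite ?Z" "?Z \<noteq> {}" using finite_T ex_root T by auto
  then obtain x where x: "x \<in> ?Z" "\<forall>z\<in>?Z. x \<le> z \<longrightarrow> x = z"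
    using finite_has_maximal[of ?Z] by blast
  have "x \<noteq> a" "x \<noteq> b" using x(1) leaf_le[of a b] leaf_le[of b a] assms T by auto
  then have "x < a" "x < b" using x by auto
  then obtain c d where c: "covers T x c" "c \<le> a" and d: "covers T x d" "d \<le> b"
    using ex_upper_cover[of x a] ex_upper_cover[of x b] x(1) T by (metis (no_types, lifting) mem_Collect_eq)
  obtain i j where ij: "i < length (ch x)" "ch x ! i = c" "j < length (ch x)" "ch x ! j = d"
    using ex_ch c d by metis
  have "c \<noteq> d" using x(2) c d by (auto simp: covers_def)
  then have "i \<noteq> j" using ij by auto
  then have "i < j \<or> j < i" by auto
  then show ?thesis using ij c d x(1) unfolding left_of_def by blast
qed

lemma leaves_finite: "finite (leaves T)" and leaves_sub: "leaves T \<subseteq> T"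
  using finite_T by (auto simp: leaves_def)

abbreviation "n \<equiv> card (leaves T)"
abbreviation "L \<equiv> interval_of T ch"

lemma leaf_rank:
  shows "bij_betw (\<lambda>z. card {y \<in> leaves T. left_of T ch y z}) (leaves T) {..<n}"
    and "a \<in> leaves T \<Longrightarrow> b \<in> leaves T \<Longrightarrow>
      card {y \<in> leaves T. left_of T ch y a} < card {y \<in> leaves T. left_of T ch y b} \<longleftrightarrow> left_of T ch a b"
proof -
  have irrefl: "\<not> left_of T ch x x" if "x \<in> leaves T" for x
    using that left_of_irrefl leaves_sub by blast
  have trans: "left_of T ch x z"
    if "x \<in> leaves T" "y \<in> leaves T" "z \<in> leaves T" "left_of T ch x y" "left_of T ch y z" for x y z
    using that left_of_trans[of x y z] leaves_sub by blast
  show "bij_betw (\<lambda>z. card {y \<in> leaves T. left_of T ch y z}) (leaves T) {..<n}"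
    by (rule rank_bij(1)[OF leaves_finite irrefl trans left_of_total])
  show "card {y \<in> leaves T. left_of T ch y a} < card {y \<in> leaves T. left_of T ch y b} \<longleftrightarrow> left_of T ch a b"
    if "a \<in> leaves T" "b \<in> leaves T"
    by (rule rank_bij(2)[OF leaves_finite irrefl trans left_of_total that])
qed

lemma label_less_iff:
  assumes "a \<in> leaves T" "b \<in> leaves T"
  shows "label T ch a < label T ch b \<longleftrightarrow> left_of T ch a b"
  unfolding label_def using leaf_rank(2)[OF assms] by simp

lemma label_bij: "bij_betw (label T ch) (leaves T) {1..n}"
proof -
  have "bij_betw (Suc \<circ> (\<lambda>z. card {y \<in> leaves T. left_of T ch y z})) (leaves T) (Suc ` {..<n})"
    by (rule bij_betw_trans[OF leaf_rank(1)]) (simp add: bij_betw_def)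
  moreover have "Suc \<circ> (\<lambda>z. card {y \<in> leaves T. left_of T ch y z}) = label T ch"
    by (auto simp: label_def)
  moreover have "Suc ` {..<n} = {1..n}" by (simp add: image_Suc_lessThan)
  ultimately show ?thesis by simp
qed

lemma label_inj: "a \<in> leaves T \<Longrightarrow> b \<in> leaves T \<Longrightarrow> label T ch a = label T ch b \<Longrightarrow> a = b"
  using label_bij by (auto simp: bij_betw_def dest: inj_onD)

lemma leaf_labelled:
  assumes "r \<in> {1..n}"
  obtains z where "z \<in> leaves T" "label T ch z = r"
proof -
  have "r \<in> label T ch ` leaves T" using assms bij_betw_imp_surj_on[OF label_bij] by simp
  then show ?thesis using that by blast
qed

lemma label_in_interval_iff: "z \<in> leaves T \<Longrightarrow> label T ch z \<in> L x \<longleftrightarrow> x \<le> z"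
  unfolding interval_of_def using label_inj by blast

lemma interval_bounded: "L x \<subseteq> {1..n}"
  using bij_betw_imp_surj_on[OF label_bij] unfolding interval_of_def by blast

lemma interval_finite: "finite (L x)"
  using interval_bounded finite_subset by blast

lemma interval_nonempty: "x \<in> T \<Longrightarrow> L x \<noteq> {}"
  using leaf_above[of x] by (auto simp: interval_of_def)

lemma interval_antimono: "x \<le> y \<Longrightarrow> L y \<subseteq> L x"
  unfolding interval_of_def by (auto intro: order_trans)

lemma interval_leaf: "z \<in> leaves T \<Longrightarrow> L z = {label T ch z}"
  unfolding interval_of_def using leaf_le leaves_sub by blast

text \<open>
  A common label belongs to a leaf above both elements.
\<close>

lemma interval_meet_comparable:
  assumes "x \<in> T" "y \<in> T" "r \<in> L x" "r \<in> L y"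
  shows "x \<le> y \<or> y \<le> x"
proof -
  obtain z where z: "z \<in> leaves T" "label T ch z = r"
    using leaf_labelled interval_bounded assms(3) by blast
  then have "x \<le> z" "y \<le> z" using assms label_in_interval_iff by blast+
  then show ?thesis using below_comparable assms z leaves_sub by blast
qed

text \<open>
  Suppose that a leaf \<open>b\<close> lies between two leaves \<open>a\<close> and \<open>c\<close> above \<open>x\<close> without being above \<open>x\<close>
  itself. Then \<open>a\<close> and \<open>b\<close> separate at a vertex \<open>y\<close> strictly below \<open>x\<close>, so all leaves above \<open>x\<close>,
  including \<open>c\<close>, are on the same side of \<open>b\<close> as \<open>a\<close>.
\<close>

lemma interval_is_interval:
  assumes "x \<in> T"
  shows "\<exists>a b. L x = {a..b}"
proof (rule nat_interval_if_convex[OF interval_finite interval_nonempty[OF assms]])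
  fix i j k assume ik: "i \<in> L x" "k \<in> L x" and less: "i < j" "j < k"
  obtain a c where ac: "a \<in> leaves T" "label T ch a = i" "x \<le> a" "c \<in> leaves T" "label T ch c = k" "x \<le> c"
    using ik by (auto simp: interval_of_def)
  have "j \<in> {1..n}" using interval_bounded ik less by fastforce
  then obtain b where b: "b \<in> leaves T" "label T ch b = j" by (rule leaf_labelled)
  have T: "a \<in> T" "b \<in> T" "c \<in> T" using ac b leaves_sub by auto
  have lo: "left_of T ch a b" "left_of T ch b c" using label_less_iff ac b less by auto
  then obtain y p q where y: "y \<in> T" "p < q" "q < length (ch y)" "ch y ! p \<le> a" "ch y ! q \<le> b"
    unfolding left_of_def by blast
  have cp: "covers T y (ch y ! p)" and cq: "covers T y (ch y ! q)" using y by (auto intro: covers_ch)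
  have "y \<le> a" using cp y by (auto simp: covers_def)
  have "x \<le> y"
  proof (rule ccontr)
    assume "\<not> x \<le> y"
    then have "y < x" using below_comparable[of x y a] assms T ac y \<open>y \<le> a\<close> by auto
    then have "ch y ! p \<le> x" using child_below[OF cp y(4)] ac assms T by blast
    then have "left_of T ch c b" using y ac unfolding left_of_def by (meson order_trans)
    then show False using lo left_of_trans left_of_irrefl T by blast
  qed
  then have "x \<le> b" using cq y by (auto simp: covers_def)
  then show "j \<in> L x" using b label_in_interval_iff by blast
qed

end

section \<open>Branches\<close>

lemma maximal_partition_unique:
  "maximal_partition \<I> J P \<Longrightarrow> maximal_partition \<I> J Q \<Longrightarrow> P = Q"
  unfolding maximal_partition_def by (intro refines_asym[of J]) simp_all

lemma maximal_proper_partition_unique: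
  "maximal_proper_partition \<I> J P \<Longrightarrow> maximal_proper_partition \<I> J Q \<Longrightarrow> P = Q"
  unfolding maximal_proper_partition_def by (intro refines_asym[of J]) simp_all

context plane_tree
begin

abbreviation "\<beta> I \<equiv> card (branch T ch I)"

definition pos :: "'a \<Rightarrow> nat" where
  "pos x = card {y \<in> branch T ch (L x). y < x}"

text \<open>
  The element at height \<open>j\<close> of the branch of \<open>I\<close>, inverse to \<open>pos\<close>. In a tiling it is what the
  column with offset \<open>j\<close> in a black tile with rows \<open>I\<close> stands for.
\<close>

definition elt :: "nat set \<Rightarrow> nat \<Rightarrow> 'a" where
  "elt I j = (THE x. x \<in> branch T ch I \<and> pos x = j)"

lemma Domain_tree_intervals: "Domain (tree_intervals T ch) = L ` T"
  unfolding tree_intervals_def by auto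

lemma tree_intervals_iff: "(I, w) \<in> tree_intervals T ch \<longleftrightarrow> I \<in> L ` T \<and> w = \<beta> I"
  unfolding tree_intervals_def by auto

lemma in_branch_iff: "x \<in> branch T ch I \<longleftrightarrow> x \<in> T \<and> L x = I"
  by (simp add: branch_def)

lemma branch_finite: "finite (branch T ch I)"
  unfolding branch_def using finite_T by simp

lemma branch_chain:
  assumes "x \<in> T" "y \<in> T" "L x = L y"
  shows "x \<le> y \<or> y \<le> x"
  using interval_meet_comparable[OF assms(1,2)] interval_nonempty[OF assms(1)] assms(3) by blast

lemma pos_bij: "bij_betw pos (branch T ch I) {..<\<beta> I}"
  and pos_less_iff: "x \<in> T \<Longrightarrow> y \<in> T \<Longrightarrow> L x = L y \<Longrightarrow> pos x < pos y \<longleftrightarrow> x < y"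
proof -
  have tot: "x < y \<or> y < x" if "x \<in> branch T ch I" "y \<in> branch T ch I" "x \<noteq> y" for x y I
    using branch_chain[of x y] that by (auto simp: in_branch_iff order_less_le)
  have "bij_betw (\<lambda>z. card {y \<in> branch T ch I. y < z}) (branch T ch I) {..<\<beta> I}"
    by (rule rank_bij(1)[OF branch_finite _ _ tot]) auto
  moreover have "pos z = card {y \<in> branch T ch I. y < z}" if "z \<in> branch T ch I" for z
    using that by (simp add: pos_def in_branch_iff)
  ultimately show "bij_betw pos (branch T ch I) {..<\<beta> I}"
    by (subst bij_betw_cong) auto
  show "pos x < pos y \<longleftrightarrow> x < y" if "x \<in> T" "y \<in> T" "L x = L y"
  proof -
    have "x \<in> branch T ch (L x)" "y \<in> branch T ch (L x)" using that by (auto simp: in_branch_iff)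
    from rank_bij(2)[where R = "(<)", OF branch_finite _ _ tot this] show ?thesis
      using that(3) unfolding pos_def by auto
  qed
qed

lemma pos_bound: "x \<in> T \<Longrightarrow> pos x < \<beta> (L x)"
  using bij_betwE[OF pos_bij[of "L x"]] by (simp add: in_branch_iff)

lemma pos_inj:
  assumes "x \<in> T" "y \<in> T" "L x = L y" "pos x = pos y"
  shows "x = y"
  using pos_less_iff[OF assms(1-3)] pos_less_iff[OF assms(2,1) assms(3)[symmetric]]
    branch_chain[OF assms(1-3)] assms(4) by (auto simp: order_less_le)

lemma elt_pos: "x \<in> T \<Longrightarrow> elt (L x) (pos x) = x"
  unfolding elt_def using pos_inj by (intro the_equality) (auto simp: in_branch_iff)

lemma elt_exists:
  assumes "j < \<beta> I"
  shows "elt I j \<in> T" and "L (elt I j) = I" and "pos (elt I j) = j"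
proof -
  have "j \<in> pos ` branch T ch I" using assms bij_betw_imp_surj_on[OF pos_bij] by simp
  then obtain x where x: "x \<in> T" "L x = I" "pos x = j" unfolding in_branch_iff[abs_def] image_iff Bex_def by metis
  moreover from x have "elt I j = x" using elt_pos[of x] by simp
  ultimately show "elt I j \<in> T" "L (elt I j) = I" "pos (elt I j) = j" by auto
qed

lemma branch_length_pos: "x \<in> T \<Longrightarrow> 0 < \<beta> (L x)"
  using pos_bound[of x] by auto

lemma elt_less:
  assumes "i < j" "j < \<beta> I"
  shows "elt I i < elt I j"
  using pos_less_iff[of "elt I i" "elt I j"] elt_exists[of i I] elt_exists[of j I] assms by simp

lemma elt_covers:
  assumes "Suc j < \<beta> I"
  shows "covers T (elt I j) (elt I (Suc j))"
proof -
  have e: "elt I j \<in> T" "L (elt I j) = I" "pos (elt I j) = j"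
    "elt I (Suc j) \<in> T" "L (elt I (Suc j)) = I" "pos (elt I (Suc j)) = Suc j"
    using elt_exists[of j I] elt_exists[of "Suc j" I] assms by auto
  have False if z: "z \<in> T" "elt I j < z" "z < elt I (Suc j)" for z
  proof -
    have "L z = I"
      using interval_antimono[of "elt I j" z] interval_antimono[of z "elt I (Suc j)"] z e
      by (simp add: less_imp_le)
    then have "j < pos z" "pos z < Suc j"
      using pos_less_iff[of "elt I j" z] pos_less_iff[of z "elt I (Suc j)"] z e by auto
    then show False by simp
  qed
  then show ?thesis unfolding covers_def using e elt_less[OF _ assms, of j] by blast
qed

lemma pos_0_iff: "x \<in> T \<Longrightarrow> pos x = 0 \<longleftrightarrow> (\<forall>y\<in>T. y < x \<longrightarrow> L y \<noteq> L x)"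
  unfolding pos_def using finite_T by (subst card_0_eq) (auto simp: in_branch_iff)

lemma above_top:
  assumes "x \<in> T" "Suc (pos x) = \<beta> (L x)" "y \<in> T" "x < y"
  shows "L y \<noteq> L x"
  using pos_less_iff[of x y] pos_bound[of y] assms by auto

text \<open>
  An element strictly below the child \<open>c\<close> is below \<open>x\<close>; if its interval were that of \<open>c\<close>, then
  \<open>x\<close> and \<open>c\<close> would have equal intervals, and \<open>x\<close> would not be the top of its branch.
\<close>

lemma child_of_top:
  assumes "Suc (pos x) = \<beta> (L x)" "covers T x c"
  shows "pos c = 0"
proof -
  have T: "x \<in> T" "c \<in> T" "x < c" using assms by (auto simp: covers_def)
  have "L y \<noteq> L c" if "y \<in> T" "y < c" for y
  proof
    assume "L y = L c"
    moreover have "L x \<subseteq> L y" using below_cover[OF assms(2) that] by (rule interval_antimono)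
    ultimately have "L c = L x" using interval_antimono[of x c] T
      by (simp add: less_imp_le)
    then show False using above_top[OF T(1) assms(1) T(2,3)] by simp
  qed
  then show ?thesis using pos_0_iff T by blast
qed

lemma card_interval_leaf: "z \<in> leaves T \<Longrightarrow> card (L z) = 1"
  by (simp add: interval_leaf)

lemma top_leaf_iff:
  assumes "x \<in> T" "Suc (pos x) = \<beta> (L x)"
  shows "card (L x) = 1 \<longleftrightarrow> x \<in> leaves T"
proof
  assume c: "card (L x) = 1"
  have False if "y \<in> T" "x < y" for y
  proof -
    have "L y \<subseteq> L x" "L y \<noteq> {}" using that by (auto simp: interval_nonempty interval_antimono less_imp_le)
    then have "L y = L x" using c by (auto simp: card_1_singleton_iff)
    then show False using above_top[OF assms that] by simp
  qed
  then show "x \<in> leaves T" using assms by (auto simp: leaves_def)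
qed (rule card_interval_leaf)

lemma child_above:
  assumes "x \<in> T" "r \<in> L x" "x \<notin> leaves T"
  obtains c where "covers T x c" "r \<in> L c"
proof -
  obtain z where z: "z \<in> leaves T" "label T ch z = r" "x \<le> z"
    using assms(2) by (auto simp: interval_of_def)
  then have "x < z" "z \<in> T" using assms leaves_sub by (auto simp: order_less_le)
  then obtain c where "covers T x c" "c \<le> z" using ex_upper_cover[of x z] assms by blast
  then show ?thesis using that label_in_interval_iff z by blast
qed

lemma tree_interval_partition_iff:
  "interval_partition_on (tree_intervals T ch) J P \<longleftrightarrow> partition_on J P \<and> P \<subseteq> L ` T"
  unfolding interval_partition_on_def Domain_tree_intervals
  using interval_is_interval by blast

text \<open>
  A block of a partition other than the trivial one is a proper subset of \<open>L x\<close>, so it is the interval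
  of an element strictly above \<open>x\<close> and lies in the interval of the child of \<open>x\<close> below that element.
\<close>

lemma maximal_proper_partition_children:
  assumes "x \<in> T" "Suc (pos x) = \<beta> (L x)" "card (L x) \<noteq> 1"
  shows "maximal_proper_partition (tree_intervals T ch) (L x) (L ` {c. covers T x c})"
proof -
  let ?P = "L ` {c. covers T x c}"
  have nleaf: "x \<notin> leaves T" using assms top_leaf_iff by blast
  have cT: "c \<in> T" "x < c" if "covers T x c" for c using that by (auto simp: covers_def)
  have part: "partition_on (L x) ?P"
  proof (rule partition_onI)
    have "L c \<subseteq> L x" if "covers T x c" for c using cT[OF that] by (simp add: interval_antimono less_imp_le)
    moreover have "\<exists>c. covers T x c \<and> r \<in> L c" if "r \<in> L x" for r
      using child_above[OF assms(1) that nleaf] by blast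
    ultimately show "\<Union> ?P = L x" by blast
    show "{} \<notin> ?P" using interval_nonempty cT by blast
    fix p q assume "p \<in> ?P" "q \<in> ?P" "p \<noteq> q"
    then obtain c d where cd: "covers T x c" "covers T x d" "p = L c" "q = L d" "c \<noteq> d" by blast
    have "\<not> c < d" "\<not> d < c" using cd(1,2) by (auto simp: covers_def)
    then have "\<not> (c \<le> d \<or> d \<le> c)" using cd(5) by (simp add: order_less_le)
    then show "disjnt p q"
      using interval_meet_comparable[of c d] cT cd by (auto simp: disjnt_iff)
  qed
  moreover have "?P \<subseteq> L ` T" using cT by blast
  moreover have "L x \<notin> ?P"
    using above_top[OF assms(1,2)] cT by (metis (no_types, lifting) imageE mem_Collect_eq)
  moreover have "refines (L x) Q ?P" if Q: "partition_on (L x) Q" "Q \<subseteq> L ` T" "Q \<noteq> {L x}" for Q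
    unfolding refines_def
  proof (intro conjI ballI Q part)
    fix K assume K: "K \<in> Q"
    then obtain w where w: "w \<in> T" "K = L w" using Q(2) by blast
    have sub: "K \<subseteq> L x" using K Q(1) by (auto simp: partition_on_def)
    have "K \<noteq> L x"
    proof
      assume eq: "K = L x"
      have "M = K" if "M \<in> Q" for M
      proof (rule ccontr)
        assume "M \<noteq> K"
        then have "M \<inter> K = {}" using Q(1) K that by (auto simp: partition_on_def disjoint_def)
        moreover have "M \<subseteq> K" "M \<noteq> {}" using Q(1) that eq by (auto simp: partition_on_def)
        ultimately show False by blast
      qed
      then show False using K Q(3) eq by blast
    qed
    then have "\<not> w \<le> x" using interval_antimono[of w x] w sub by blast
    moreover obtain r where r: "r \<in> L w" using interval_nonempty w by blast
    ultimately have "x < w" using interval_meet_comparable[of w x r] w sub assms(1) by auto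
    then obtain c where "covers T x c" "c \<le> w" using ex_upper_cover[of x w] w assms by blast
    then show "\<exists>Y\<in>?P. K \<subseteq> Y" using interval_antimono w by blast
  qed
  ultimately show ?thesis
    unfolding maximal_proper_partition_def tree_interval_partition_iff by blast
qed

end

section \<open>Rowmotion\<close>

lemma ex_maximal_interval:
  assumes "finite Y" "r \<in> Y"
  obtains J where "maximal_interval_in J Y" "r \<in> J"
proof -
  let ?F = "{J. r \<in> J \<and> J \<subseteq> Y \<and> (\<exists>a b. J = {a..b})}"
  have "?F \<subseteq> Pow Y" by blast
  then have fin: "finite ?F" using assms(1) by (simp add: finite_subset)
  have "{r..r} \<in> ?F" using assms(2) by fastforce
  then have "?F \<noteq> {}" by blast
  from finite_has_maximal[OF fin this]
  obtain J where J: "J \<in> ?F" and max: "\<forall>K\<in>?F. J \<subseteq> K \<longrightarrow> J = K"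
    by (elim bexE) (rule that)
  have r: "r \<in> J" "J \<subseteq> Y" "\<exists>a b. J = {a..b}" using J by simp_all
  have "{a..b} = J" if "J \<subseteq> {a..b}" "{a..b} \<subseteq> Y" for a b
    using bspec[OF max, of "{a..b}"] that r(1) by blast
  then have "maximal_interval_in J Y" using r unfolding maximal_interval_in_def by blast
  then show ?thesis using r(1) that by blast
qed

text \<open>
  The union of two intersecting intervals is an interval.
\<close>

lemma maximal_interval_absorbs:
  assumes "maximal_interval_in J Y" "r \<in> J" "r \<in> K" "K \<subseteq> Y" "\<exists>a b. K = {a..b}"
  shows "K \<subseteq> J"
proof -
  obtain a b where J: "J = {a..b}" using assms(1) by (auto simp: maximal_interval_in_def)
  obtain c d where K: "K = {c..d}" using assms(5) by blast
  have "J \<union> K = {min a c..max b d}" using assms(2,3) by (auto simp: J K min_def max_def)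
  then have "{min a c..max b d} = J"
    using assms(1,4) unfolding maximal_interval_in_def by blast
  then show ?thesis using \<open>J \<union> K = _\<close> by blast
qed

context plane_tree
begin

abbreviation "\<rho> \<equiv> rowmotion T"

lemma antichain_sub: "A \<in> antichains T \<Longrightarrow> x \<in> A \<Longrightarrow> x \<in> T"
  by (auto simp: antichains_def)

lemma antichain_le: "A \<in> antichains T \<Longrightarrow> x \<in> A \<Longrightarrow> y \<in> A \<Longrightarrow> x \<le> y \<Longrightarrow> x = y"
  by (auto simp: antichains_def order_less_le)

lemma antichain_unique:
  assumes "A \<in> antichains T" "x \<in> A" "y \<in> A" "r \<in> L x" "r \<in> L y"
  shows "x = y"
  using interval_meet_comparable[of x y r] assms antichain_le antichain_sub by blast

lemma in_rowmotion_iff: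
  "x \<in> \<rho> A \<longleftrightarrow> x \<in> T \<and> x \<notin> down T A \<and> (\<forall>y\<in>T. y < x \<longrightarrow> y \<in> down T A)"
  unfolding rowmotion_def min_elems_def by blast

lemma rowmotion_antichain: "\<rho> A \<in> antichains T"
  unfolding antichains_def by (auto simp: in_rowmotion_iff)

lemma rowmotion_pow_antichain: "A \<in> antichains T \<Longrightarrow> (\<rho> ^^ k) A \<in> antichains T"
  by (cases k) (simp_all add: rowmotion_antichain)

lemma rowmotion_below:
  assumes "w \<in> T" "w \<notin> down T A"
  obtains x where "x \<in> \<rho> A" "x \<le> w"
  using min_below[of "{x \<in> T. x \<notin> down T A}" w] assms unfolding rowmotion_def by blast

text \<open>
  The down-set of \<open>A\<close> can be recovered from \<open>\<rho> A\<close>, as the complement of the up-set that \<open>\<rho> A\<close>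
  generates. Together with the fact that an antichain is determined by its down-set, this makes
  rowmotion injective.
\<close>

lemma down_rowmotion: "down T A = {x \<in> T. \<not> (\<exists>y\<in>\<rho> A. y \<le> x)}"
proof (intro set_eqI iffI)
  fix x assume x: "x \<in> down T A"
  have "x \<in> T" using x by (simp add: down_def)
  moreover have False if "y \<in> \<rho> A" "y \<le> x" for y
  proof -
    have "y \<in> down T A" using that x unfolding down_def in_rowmotion_iff by (blast intro: order_trans)
    then show False using that(1) in_rowmotion_iff by blast
  qed
  ultimately show "x \<in> {x \<in> T. \<not> (\<exists>y\<in>\<rho> A. y \<le> x)}" by blast
next
  fix x assume "x \<in> {x \<in> T. \<not> (\<exists>y\<in>\<rho> A. y \<le> x)}"
  then show "x \<in> down T A" using rowmotion_below[of x A] by blast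
qed

text \<open>
  An antichain consists of the maximal elements of its down-set.
\<close>

lemma antichain_down_inj:
  assumes "A \<in> antichains T" "B \<in> antichains T" "down T A = down T B"
  shows "A \<subseteq> B"
proof
  fix x assume x: "x \<in> A"
  then have "x \<in> down T B" using assms antichain_sub[of A x] unfolding down_def by blast
  then obtain y where y: "y \<in> B" "x \<le> y" by (auto simp: down_def)
  then have "y \<in> down T A" using assms antichain_sub[of B y] unfolding down_def by blast
  then obtain z where "z \<in> A" "y \<le> z" by (auto simp: down_def)
  then have "x = z" using antichain_le[OF assms(1) x] y by (meson order_trans)
  then show "x \<in> B" using y \<open>y \<le> z\<close> by auto
qed

lemma rowmotion_inj: "inj_on \<rho> (antichains T)"
proof (rule inj_onI)
  fix A B assume "A \<in> antichains T" "B \<in> antichains T" "\<rho> A = \<rho> B"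
  moreover from \<open>\<rho> A = \<rho> B\<close> have "down T A = down T B" unfolding down_rowmotion by simp
  ultimately show "A = B" using antichain_down_inj[of A B] antichain_down_inj[of B A] by auto
qed

lemma rowmotion_pow_cancel:
  assumes "A \<in> antichains T" "B \<in> antichains T" "(\<rho> ^^ k) A = (\<rho> ^^ k) B"
  shows "A = B"
  using assms(3)
proof (induction k)
  case (Suc k)
  then show ?case using rowmotion_inj rowmotion_pow_antichain assms
    by (auto dest: inj_onD)
qed simp

text \<open>
  An injective map on a finite set is periodic.
\<close>

lemma antichain_in_orbit:
  assumes "A \<in> antichains T"
  shows "A \<in> orbit \<rho> A"
proof -
  have "finite (antichains T)" using finite_T by (auto simp: antichains_def)
  moreover have "range (\<lambda>k. (\<rho> ^^ k) A) \<subseteq> antichains T" using rowmotion_pow_antichain assms by blast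
  ultimately have "finite (range (\<lambda>k. (\<rho> ^^ k) A))" using finite_subset by blast
  then have "\<not> inj (\<lambda>k. (\<rho> ^^ k) A)" using finite_imageD infinite_UNIV_nat by blast
  then obtain i j where ij: "(\<rho> ^^ i) A = (\<rho> ^^ j) A" "i < j"
    unfolding inj_def by (metis nat_neq_iff)
  then have "(\<rho> ^^ i) ((\<rho> ^^ (j - i)) A) = (\<rho> ^^ i) A"
    by (metis add_diff_inverse_nat comp_apply funpow_add less_imp_not_less)
  then have "(\<rho> ^^ (j - i)) A = A" using rowmotion_pow_cancel rowmotion_pow_antichain assms by blast
  then show ?thesis using ij(2) unfolding orbit_altdef
    by (intro CollectI exI[of _ "j - i"]) auto
qed

lemma cover_in_rowmotion:
  assumes "A \<in> antichains T" "x \<in> A" "covers T x c"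
  shows "c \<in> \<rho> A"
proof -
  have T: "x \<in> T" "c \<in> T" "x < c" using assms(3) by (auto simp: covers_def)
  have "c \<notin> down T A"
  proof
    assume "c \<in> down T A"
    then obtain a where a: "a \<in> A" "c \<le> a" by (auto simp: down_def)
    have "x < a" using T(3) a(2) by (rule order_less_le_trans)
    then show False using assms(1,2) a(1) by (auto simp: antichains_def)
  qed
  moreover have "y \<in> down T A" if "y \<in> T" "y < c" for y
    using below_cover[OF assms(3) that] that assms(2) by (auto simp: down_def)
  ultimately show ?thesis using T in_rowmotion_iff by blast
qed

text \<open>
  From right to left this is \<open>cover_in_rowmotion\<close>. Conversely, the lower cover \<open>p\<close> of the new
  element \<open>x\<close> is below some \<open>a \<in> A\<close>. As \<open>p\<close> and \<open>x\<close> have the same interval, \<open>a\<close> is comparable to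
  \<open>x\<close>, and since \<open>x\<close> is not in the down-set of \<open>A\<close>, this leaves only \<open>a = p\<close>. If \<open>p\<close> had several
  children, \<open>a\<close> could instead lie above another one of them.
\<close>

lemma rowmotion_branch:
  assumes "A \<in> antichains T" "Suc j < \<beta> I"
  shows "elt I (Suc j) \<in> \<rho> A \<longleftrightarrow> elt I j \<in> A"
proof
  let ?x = "elt I (Suc j)" and ?p = "elt I j"
  have cov: "covers T ?p ?x" by (rule elt_covers[OF assms(2)])
  then have T: "?p \<in> T" "?x \<in> T" "?p < ?x" by (auto simp: covers_def)
  show "?x \<in> \<rho> A" if "?p \<in> A" by (rule cover_in_rowmotion[OF assms(1) that cov])
  assume x: "?x \<in> \<rho> A"
  then have "?p \<in> down T A" using T unfolding in_rowmotion_iff by blast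
  then obtain a where a: "a \<in> A" "?p \<le> a" by (auto simp: down_def)
  have aT: "a \<in> T" using antichain_sub[OF assms(1) a(1)] .
  have nle: "\<not> ?x \<le> a" using x a T unfolding in_rowmotion_iff down_def by blast
  obtain r where r: "r \<in> L a" using interval_nonempty[OF aT] by blast
  then have "r \<in> L ?x" using interval_antimono[OF a(2)] elt_exists assms(2) by auto
  then have "a < ?x" using interval_meet_comparable[OF aT T(2) r] nle by auto
  then have "a \<le> ?p" using below_cover[OF cov aT] by blast
  then have "a = ?p" using a by simp
  then show "?p \<in> A" using a by simp
qed

lemma rowmotion_pow_branch:
  assumes "A \<in> antichains T" "j < \<beta> I"
  shows "elt I j \<in> (\<rho> ^^ j) A \<longleftrightarrow> elt I 0 \<in> A"
  using assms(2)
proof (induction j)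
  case (Suc j)
  then show ?case using rowmotion_branch[OF rowmotion_pow_antichain[OF assms(1)] Suc.prems, of j] by simp
qed simp

lemma leaf_not_covered_next:
  assumes "A \<in> antichains T" "z \<in> A" "z \<in> leaves T" "x \<in> \<rho> A" "r \<in> L x"
  shows "r \<notin> L z"
proof
  assume "r \<in> L z"
  then have "x \<le> z \<or> z \<le> x"
    using interval_meet_comparable[of x z r] assms in_rowmotion_iff leaves_sub by blast
  then have "x \<le> z" using leaf_le[of z x] assms in_rowmotion_iff by auto
  then show False using assms(2,4) unfolding in_rowmotion_iff down_def by blast
qed

section \<open>The rows left free by an antichain\<close>

text \<open>
  These are the rows of the yellow boxes in the column of \<open>A\<close>.
\<close>

definition free_rows :: "'a set \<Rightarrow> nat set" where
  "free_rows A = {1..n} - \<Union> (L ` A)"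

text \<open>
  A minimal element \<open>x \<le> w\<close> outside the down-set of \<open>A\<close> belongs to \<open>\<rho> A\<close>. No row of \<open>x\<close> is covered
  by \<open>A\<close>: otherwise \<open>x\<close> would be above an element of \<open>A\<close>, and then all rows of \<open>x\<close>, among them the
  free row \<open>r\<close>, would be covered. So the interval of \<open>x\<close> consists of free rows and is absorbed by \<open>J\<close>.
\<close>

lemma rowmotion_below_free:
  assumes "maximal_interval_in J (free_rows A)" "A \<in> antichains T"
    and "w \<in> T" "w \<notin> down T A" "r \<in> L w" "r \<in> J"
  obtains x where "x \<in> \<rho> A" "x \<le> w" "L x \<subseteq> J"
proof -
  obtain x where x: "x \<in> \<rho> A" "x \<le> w" using rowmotion_below assms(3,4) .
  have xT: "x \<in> T" "x \<notin> down T A" using x in_rowmotion_iff by blast+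
  have rx: "r \<in> L x" using interval_antimono x assms by blast
  have "r \<in> free_rows A" using assms(1,6) unfolding maximal_interval_in_def by blast
  have "s \<notin> L a" if "s \<in> L x" "a \<in> A" for s a
  proof
    assume "s \<in> L a"
    have aT: "a \<in> T" using antichain_sub assms(2) that by blast
    have "\<not> x \<le> a" using xT that unfolding down_def by blast
    then have "a \<le> x" using interval_meet_comparable[OF xT(1) aT that(1) \<open>s \<in> L a\<close>] by blast
    then have "r \<in> L a" using rx interval_antimono by blast
    then show False using \<open>r \<in> free_rows A\<close> that unfolding free_rows_def by blast
  qed
  then have "L x \<subseteq> free_rows A" using interval_bounded unfolding free_rows_def by blast
  then have "L x \<subseteq> J"
    using maximal_interval_absorbs[OF assms(1,6) rx] interval_is_interval xT by blast
  then show ?thesis using x that by blast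
qed

lemma not_down_if_free:
  assumes "w \<in> T" "A \<in> antichains T" "L w \<subseteq> free_rows A"
  shows "w \<notin> down T A"
proof
  assume "w \<in> down T A"
  then obtain a where a: "a \<in> A" "w \<le> a" by (auto simp: down_def)
  then obtain r where "r \<in> L a" using interval_nonempty antichain_sub assms by blast
  moreover have "r \<in> L w" using interval_antimono a \<open>r \<in> L a\<close> by blast
  ultimately show False using assms(3) a unfolding free_rows_def by blast
qed

text \<open>
  An element below \<open>x\<close> on the same branch would have only free rows as well, hence it would not be
  in the down-set of \<open>A\<close>, contrary to the minimality of \<open>x\<close>.
\<close>

lemma free_new_is_bottom:
  assumes "A \<in> antichains T" "x \<in> \<rho> A" "L x \<subseteq> free_rows A"
  shows "pos x = 0"
proof -
  have "L y \<noteq> L x" if "y \<in> T" "y < x" for y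
    using not_down_if_free[of y A] that assms in_rowmotion_iff by auto
  then show ?thesis using pos_0_iff assms(2) in_rowmotion_iff by blast
qed

definition new_intervals :: "'a set \<Rightarrow> nat set \<Rightarrow> nat set set" where
  "new_intervals A J = L ` {x \<in> \<rho> A. L x \<subseteq> J}"

lemma new_intervals_cover:
  assumes "maximal_interval_in J (free_rows A)" "A \<in> antichains T" "r \<in> J"
  obtains x where "x \<in> \<rho> A" "r \<in> L x" "L x \<subseteq> J"
proof -
  have r: "r \<in> free_rows A" using assms(1,3) unfolding maximal_interval_in_def by blast
  then obtain z where z: "z \<in> leaves T" "label T ch z = r"
    using leaf_labelled unfolding free_rows_def by blast
  have zT: "z \<in> T" "r \<in> L z" using z leaves_sub interval_leaf by auto
  have "z \<notin> down T A" using r z interval_leaf by (intro not_down_if_free zT assms) auto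
  then obtain x where "x \<in> \<rho> A" "x \<le> z" "L x \<subseteq> J"
    using rowmotion_below_free[OF assms(1,2) zT(1) _ zT(2) assms(3)] by blast
  then show ?thesis using that interval_antimono zT by blast
qed

text \<open>
  This is the reason for (t2). A tree interval \<open>L w\<close> inside \<open>J\<close> consists of free rows, so \<open>w\<close> is
  above an element of \<open>\<rho> A\<close> by \<open>rowmotion_below_free\<close>, and the interval of that element contains \<open>L w\<close>.
\<close>

lemma maximal_partition_new_intervals:
  assumes "maximal_interval_in J (free_rows A)" "A \<in> antichains T"
  shows "maximal_partition (tree_intervals T ch) J (new_intervals A J)"
proof -
  have J: "J \<subseteq> free_rows A" using assms(1) unfolding maximal_interval_in_def by blast
  have rT: "x \<in> T" if "x \<in> \<rho> A" for x using that in_rowmotion_iff by blast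
  have part: "partition_on J (new_intervals A J)"
  proof (rule partition_onI)
    show "\<Union> (new_intervals A J) = J"
      using new_intervals_cover[OF assms] unfolding new_intervals_def by blast
    show "{} \<notin> new_intervals A J" using interval_nonempty rT unfolding new_intervals_def by blast
    fix p q assume "p \<in> new_intervals A J" "q \<in> new_intervals A J" "p \<noteq> q"
    then show "disjnt p q"
      using antichain_unique[OF rowmotion_antichain[of A]] unfolding new_intervals_def disjnt_iff by blast
  qed
  moreover have "new_intervals A J \<subseteq> L ` T" using rT unfolding new_intervals_def by blast
  moreover have "refines J Q (new_intervals A J)" if Q: "partition_on J Q" "Q \<subseteq> L ` T" for Q
    unfolding refines_def
  proof (intro conjI ballI Q part)
    fix K assume K: "K \<in> Q"
    then obtain w where w: "w \<in> T" "K = L w" using Q(2) by blast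
    obtain r where r: "r \<in> L w" using interval_nonempty w by blast
    have sub: "K \<subseteq> J" using K Q(1) by (auto simp: partition_on_def)
    then have "w \<notin> down T A" using w J assms by (intro not_down_if_free) auto
    moreover have "r \<in> J" using r sub w by blast
    ultimately obtain x where x: "x \<in> \<rho> A" "x \<le> w" "L x \<subseteq> J"
      using rowmotion_below_free[OF assms w(1) _ r] by blast
    have "K \<subseteq> L x" using interval_antimono[OF x(2)] w(2) by simp
    moreover have "L x \<in> new_intervals A J" using x unfolding new_intervals_def by simp
    ultimately show "\<exists>Y\<in>new_intervals A J. K \<subseteq> Y" by blast
  qed
  ultimately show ?thesis
    unfolding maximal_partition_def tree_interval_partition_iff by blast
qed

end

section \<open>The cylinder of a periodic rowmotion sequence\<close>

text \<open>
  The column \<open>c - j\<close> modulo \<open>N\<close>, from which \<open>j\<close> steps lead to column \<open>c\<close>; the multiple of \<open>N\<close> is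
  there since subtraction of natural numbers truncates.
\<close>

definition first_column :: "nat \<Rightarrow> nat \<Rightarrow> nat \<Rightarrow> nat" where
  "first_column N c j = (c + (N * j - j)) mod N"

lemma first_column_add:
  assumes "0 < N"
  shows "(first_column N c j + j) mod N = c mod N"
proof -
  have "j \<le> N * j" using assms by simp
  then have "c + (N * j - j) + j = c + N * j" by linarith
  then show ?thesis unfolding first_column_def by (metis mod_add_left_eq mod_mult_self2)
qed

lemma add_mod_eq_iff_first_column:
  assumes "0 < N" "s < N" "c < N"
  shows "(s + j) mod N = c \<longleftrightarrow> s = first_column N c j"
proof
  have "j \<le> N * j" using assms by simp
  then have eq: "s + j + (N * j - j) = s + N * j" by linarith
  assume "(s + j) mod N = c"
  then have "first_column N c j = (s + j + (N * j - j)) mod N" unfolding first_column_def by (metis mod_add_left_eq)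
  also have "\<dots> = s" using eq assms(2) by simp
  finally show "s = first_column N c j" by simp
next
  assume "s = first_column N c j"
  then show "(s + j) mod N = c" using first_column_add[OF assms(1), of c j] assms(3) by simp
qed

lemma first_column_less: "0 < N \<Longrightarrow> first_column N c j < N"
  by (simp add: first_column_def)

context plane_tree
begin

text \<open>
  The number \<open>N\<close> is a period, not necessarily the smallest one: a tiling that is not primitive
  repeats the picture of an orbit several times.
\<close>

definition periodic :: "nat \<Rightarrow> 'a set \<Rightarrow> bool" where
  "periodic N A \<longleftrightarrow> A \<in> antichains T \<and> 0 < N \<and> (\<rho> ^^ N) A = A"

text \<open>
  Each branch is entered at its bottom element and contributes a tile of full length from there on.
\<close>

definition tiles :: "nat \<Rightarrow> 'a set \<Rightarrow> tile set" where
  "tiles N A =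
     {Tile Black (L x) s (\<beta> (L x)) | x s. s < N \<and> x \<in> (\<rho> ^^ s) A \<and> pos x = 0} \<union>
     {Tile Yellow {r} s 1 | r s. s < N \<and> r \<in> free_rows ((\<rho> ^^ s) A)}"

lemma Black_in_tiles_iff:
  "Tile Black I s w \<in> tiles N A \<longleftrightarrow>
     s < N \<and> w = \<beta> I \<and> (\<exists>x\<in>(\<rho> ^^ s) A. pos x = 0 \<and> L x = I)"
  unfolding tiles_def by auto

lemma Yellow_in_tiles_iff:
  "Tile Yellow R s w \<in> tiles N A \<longleftrightarrow> s < N \<and> w = 1 \<and> (\<exists>r\<in>free_rows ((\<rho> ^^ s) A). R = {r})"
  unfolding tiles_def by auto

lemma periodic_antichain: "periodic N A \<Longrightarrow> (\<rho> ^^ s) A \<in> antichains T"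
  unfolding periodic_def using rowmotion_pow_antichain by blast

lemma periodic_mod: "periodic N A \<Longrightarrow> (\<rho> ^^ (s mod N)) A = (\<rho> ^^ s) A"
  unfolding periodic_def using funpow_mod_eq by metis

lemma periodic_pos: "periodic N A \<Longrightarrow> 0 < N"
  unfolding periodic_def by simp

lemma bottom_in_tiles_iff:
  assumes "periodic N A" "0 < \<beta> I"
  shows "Tile Black I s w \<in> tiles N A \<longleftrightarrow> s < N \<and> w = \<beta> I \<and> elt I 0 \<in> (\<rho> ^^ s) A"
proof -
  have "x = elt I 0" if "x \<in> (\<rho> ^^ s) A" "pos x = 0" "L x = I" for x
    using elt_pos[of x] that antichain_sub[OF periodic_antichain[OF assms(1)]] by auto
  then show ?thesis using elt_exists[OF assms(2)] unfolding Black_in_tiles_iff by auto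
qed

text \<open>
  A black tile either carries its branch elements in all its columns or in none of them.
\<close>

lemma elt_along_tile:
  assumes "periodic N A" "j < \<beta> I" "(s + j) mod N = c mod N"
  shows "elt I j \<in> (\<rho> ^^ c) A \<longleftrightarrow> elt I 0 \<in> (\<rho> ^^ s) A"
proof -
  have "(\<rho> ^^ c) A = (\<rho> ^^ (s + j)) A" using periodic_mod[OF assms(1)] assms(3) by metis
  also have "\<dots> = (\<rho> ^^ j) ((\<rho> ^^ s) A)" by (simp add: funpow_add add.commute[of s])
  finally show ?thesis using rowmotion_pow_branch[OF periodic_antichain[OF assms(1)] assms(2)] by simp
qed

lemma elt_on_tile:
  assumes "periodic N A" "x \<in> (\<rho> ^^ c) A"
  shows "Tile Black (L x) (first_column N c (pos x)) (\<beta> (L x)) \<in> tiles N A"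
proof -
  have T: "x \<in> T" using antichain_sub[OF periodic_antichain] assms by blast
  have N: "0 < N" using assms periodic_pos by blast
  have "elt (L x) 0 \<in> (\<rho> ^^ (first_column N c (pos x))) A"
    using elt_along_tile[OF assms(1) pos_bound[OF T] first_column_add[OF N, of c]] elt_pos[OF T] assms(2) by simp
  then show ?thesis
    using bottom_in_tiles_iff[OF assms(1) branch_length_pos[OF T]] first_column_less[OF N] by blast
qed

text \<open>
  Otherwise the antichain in column \<open>s\<close> would contain two elements of one branch, namely the bottom
  one and, one round later, the one \<open>N\<close> steps above it.
\<close>

lemma branch_length_le_period:
  assumes "periodic N A" "elt I 0 \<in> (\<rho> ^^ s) A"
  shows "\<beta> I \<le> N"
proof (rule ccontr)
  assume "\<not> \<beta> I \<le> N"
  then have N: "N < \<beta> I" by simp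
  then have "elt I N \<in> (\<rho> ^^ s) A" using elt_along_tile[OF assms(1) N, of s s] assms(2) by simp
  moreover have "elt I 0 < elt I N" using elt_less[of 0 N I] N periodic_pos[OF assms(1)] by simp
  ultimately show False
    using assms(2) periodic_antichain[OF assms(1), of s] unfolding antichains_def by blast
qed

text \<open>
  The tile at a box is forced: by the unique element of the column that covers the row, together
  with its position on its branch, or by the absence of such an element.
\<close>

lemma tile_covers_iff:
  assumes "periodic N A" "c < N" "r \<in> {1..n}" "t \<in> tiles N A"
  shows "tile_covers N t r c \<longleftrightarrow>
    (\<exists>x\<in>(\<rho> ^^ c) A. r \<in> L x \<and> t = Tile Black (L x) (first_column N c (pos x)) (\<beta> (L x))) \<or>
    (r \<in> free_rows ((\<rho> ^^ c) A) \<and> t = Tile Yellow {r} c 1)" (is "?l = ?R")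
proof -
  obtain k R s w where t: "t = Tile k R s w" by (cases t)
  have N: "0 < N" using assms periodic_pos by blast
  show ?thesis
  proof (cases k)
    case Black
    have s: "s < N" "w = \<beta> R" and "\<exists>x\<in>(\<rho> ^^ s) A. pos x = 0 \<and> L x = R"
      using assms(4) t Black Black_in_tiles_iff by auto
    then have "R \<in> L ` T" using antichain_sub[OF periodic_antichain[OF assms(1)]] by blast
    then have b: "0 < \<beta> R" using branch_length_pos by auto
    have e0: "elt R 0 \<in> (\<rho> ^^ s) A"
      using bottom_in_tiles_iff[OF assms(1) b] assms(4) t Black by simp
    show ?thesis
    proof
      assume "tile_covers N t r c"
      then obtain j where j: "r \<in> R" "j < w" "c = (s + j) mod N" by (auto simp: tile_covers_def t)
      then have x: "elt R j \<in> (\<rho> ^^ c) A"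
        using elt_along_tile[OF assms(1), of j R s c] e0 s by simp
      have "s = first_column N c j" using add_mod_eq_iff_first_column[OF N s(1) assms(2), of j] j(3) by simp
      then show ?R using x elt_exists[of j R] j s t Black by (intro disjI1 bexI[OF _ x]) auto
    next
      assume ?R
      then obtain x where x: "x \<in> (\<rho> ^^ c) A" "r \<in> L x" "R = L x" "s = first_column N c (pos x)"
        using t Black by auto
      have "x \<in> T" using antichain_sub[OF periodic_antichain] assms(1) x by blast
      then have "pos x < w" using pos_bound x s by simp
      moreover have "c = (s + pos x) mod N" using first_column_add[OF N, of c "pos x"] x assms(2) by simp
      ultimately show "tile_covers N t r c" using x t by (auto simp: tile_covers_def)
    qed
  next
    case Yellow
    then have "s < N" "w = 1" "\<exists>r\<in>free_rows ((\<rho> ^^ s) A). R = {r}"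
      using assms(4) t Yellow_in_tiles_iff by auto
    then show ?thesis using t Yellow assms(2) by (auto simp: tile_covers_def)
  qed
qed

lemma tiles_cylinder_tiling:
  assumes "periodic N A"
  shows "cylinder_tiling n (N, tiles N A)"
proof -
  have N: "0 < N" using assms periodic_pos by blast
  have bounds: "rows t \<subseteq> {1..n} \<and> start t < N \<and> width t \<le> N" if t: "t \<in> tiles N A" for t
  proof (cases t)
    case (Tile k R s w)
    show ?thesis
    proof (cases k)
      case Black
      obtain x where x: "x \<in> (\<rho> ^^ s) A" "L x = R" using t Tile Black Black_in_tiles_iff by auto
      then have "x \<in> T" using antichain_sub[OF periodic_antichain] assms by blast
      then have "0 < \<beta> R" using branch_length_pos x by auto
      then have "s < N" "w = \<beta> R" "elt R 0 \<in> (\<rho> ^^ s) A"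
        using that Tile Black bottom_in_tiles_iff[OF assms] by auto
      then show ?thesis using branch_length_le_period[OF assms] interval_bounded x Tile by auto
    next
      case Yellow
      then show ?thesis using that Tile N by (auto simp: Yellow_in_tiles_iff free_rows_def)
    qed
  qed
  have cover: "\<exists>!t. t \<in> tiles N A \<and> tile_covers N t r c" if r: "r \<in> {1..n}" and c: "c < N" for r c
  proof (cases "r \<in> free_rows ((\<rho> ^^ c) A)")
    case True
    then have "r \<notin> L x" if "x \<in> (\<rho> ^^ c) A" for x using that by (auto simp: free_rows_def)
    moreover have "Tile Yellow {r} c 1 \<in> tiles N A" using True c Yellow_in_tiles_iff by simp
    ultimately show ?thesis using tile_covers_iff[OF assms c r] True
      by (intro ex1I[of _ "Tile Yellow {r} c 1"]) blast+
  next
    case False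
    then obtain x where x: "x \<in> (\<rho> ^^ c) A" "r \<in> L x" using r by (auto simp: free_rows_def)
    let ?t = "Tile Black (L x) (first_column N c (pos x)) (\<beta> (L x))"
    have t: "?t \<in> tiles N A" by (rule elt_on_tile[OF assms x(1)])
    have "y = x" if "y \<in> (\<rho> ^^ c) A" "r \<in> L y" for y
      by (rule antichain_unique[OF periodic_antichain[OF assms] that(1) x(1) that(2) x(2)])
    then show ?thesis using tile_covers_iff[OF assms c r] False x t
      by (intro ex1I[of _ ?t]) blast+
  qed
  show ?thesis unfolding cylinder_tiling_def using N bounds cover by blast
qed

lemma yellow_rows_tiles: "c < N \<Longrightarrow> yellow_rows (tiles N A) c = free_rows ((\<rho> ^^ c) A)"
  unfolding yellow_rows_def by (auto simp: Yellow_in_tiles_iff)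

lemma tiles_t1:
  assumes "periodic N A"
  shows "tiling_t1 (tree_intervals T ch) (N, tiles N A)"
proof -
  have N: "0 < N" using assms periodic_pos by blast
  have "if card I = 1 then Tile Yellow I ((s + w) mod N) 1 \<in> tiles N A
     else \<exists>P. maximal_proper_partition (tree_intervals T ch) I P \<and>
       black_tiles_at (tiles N A) P ((s + w) mod N)" if t: "Tile Black I s w \<in> tiles N A" for I s w
  proof -
    have w: "w = \<beta> I" and "\<exists>x\<in>(\<rho> ^^ s) A. pos x = 0 \<and> L x = I" using t Black_in_tiles_iff by auto
    then have "I \<in> L ` T" using antichain_sub[OF periodic_antichain[OF assms]] by blast
    then have b: "0 < \<beta> I" using branch_length_pos by auto
    then obtain j where j: "w = Suc j" using w by (metis gr0_implies_Suc)
    define x where "x = elt I j"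
    define D where "D = (\<rho> ^^ (s + j)) A"
    have D: "D \<in> antichains T" unfolding D_def by (rule periodic_antichain[OF assms])
    have x: "x \<in> T" "L x = I" "Suc (pos x) = \<beta> (L x)"
      using elt_exists[of j I] j w unfolding x_def by auto
    have xD: "x \<in> D"
      unfolding x_def D_def using elt_along_tile[OF assms, of j I s "s + j"] t j w
        bottom_in_tiles_iff[OF assms b] by simp
    let ?c = "(s + w) mod N"
    have c: "?c < N" "(\<rho> ^^ ?c) A = \<rho> D" using N periodic_mod[OF assms] j by (auto simp: D_def)
    show ?thesis
    proof (cases "card I = 1")
      case True
      then have leaf: "x \<in> leaves T" using top_leaf_iff x by blast
      obtain r where r: "I = {r}" using True by (auto simp: card_1_singleton_iff)
      have "r \<notin> L y" if "y \<in> \<rho> D" for y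
        using leaf_not_covered_next[OF D xD leaf that, of r] x r by auto
      moreover have "r \<in> {1..n}" using interval_bounded[of x] x r by auto
      ultimately have "r \<in> free_rows (\<rho> D)" unfolding free_rows_def by blast
      then show ?thesis using True c r by (simp add: Yellow_in_tiles_iff)
    next
      case False
      have "Tile Black (L y) ?c (\<beta> (L y)) \<in> tiles N A" if "covers T x y" for y
        using cover_in_rowmotion[OF D xD that] child_of_top[OF x(3) that] c Black_in_tiles_iff by auto
      then have "black_tiles_at (tiles N A) (L ` {y. covers T x y}) ?c"
        unfolding black_tiles_at_def by blast
      then show ?thesis using maximal_proper_partition_children[OF x(1,3)] False x(2) by auto
    qed
  qed
  then show ?thesis unfolding tiling_t1_def by blast
qed

lemma tiles_t2:
  assumes "periodic N A"
  shows "tiling_t2 (tree_intervals T ch) (N, tiles N A)"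
proof -
  have N: "0 < N" using assms periodic_pos by blast
  have "\<exists>P. maximal_partition (tree_intervals T ch) J P \<and> black_tiles_at (tiles N A) P (Suc c mod N)"
    if c: "c < N" and J: "maximal_interval_in J (yellow_rows (tiles N A) c)" for c J
  proof -
    let ?D = "(\<rho> ^^ c) A"
    have D: "?D \<in> antichains T" by (rule periodic_antichain[OF assms])
    have J: "maximal_interval_in J (free_rows ?D)" using J yellow_rows_tiles c by simp
    then have sub: "J \<subseteq> free_rows ?D" unfolding maximal_interval_in_def by blast
    have "(\<rho> ^^ (Suc c mod N)) A = \<rho> ?D" using periodic_mod[OF assms] by simp
    then have "Tile Black (L x) (Suc c mod N) (\<beta> (L x)) \<in> tiles N A" if "x \<in> \<rho> ?D" "L x \<subseteq> J" for x
      using free_new_is_bottom[OF D that(1)] that sub N Black_in_tiles_iff by auto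
    then have "black_tiles_at (tiles N A) (new_intervals ?D J) (Suc c mod N)"
      unfolding black_tiles_at_def new_intervals_def by blast
    then show ?thesis using maximal_partition_new_intervals[OF J D] by blast
  qed
  then show ?thesis unfolding tiling_t2_def by blast
qed

lemma tiles_shapes:
  assumes "periodic N A"
  shows "tile_shapes (tree_intervals T ch) (N, tiles N A)"
proof -
  have "case colour t of Black \<Rightarrow> (rows t, width t) \<in> tree_intervals T ch
    | Yellow \<Rightarrow> (rows t, width t) \<in> {(I, 1) | I. I \<in> Domain (tree_intervals T ch) \<and> card I = 1}"
    if t: "t \<in> tiles N A" for t
  proof (cases t)
    case (Tile k R s w)
    show ?thesis
    proof (cases k)
      case Black
      then show ?thesis
        using that Tile antichain_sub[OF periodic_antichain[OF assms]]
        by (auto simp: Black_in_tiles_iff tree_intervals_iff)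
    next
      case Yellow
      then obtain r where r: "R = {r}" "w = 1" "r \<in> {1..n}"
        using t Tile by (auto simp: Yellow_in_tiles_iff free_rows_def)
      obtain z where "z \<in> leaves T" "label T ch z = r" using leaf_labelled r(3) by blast
      then have "R \<in> L ` T" using interval_leaf[of z] leaves_sub r by auto
      then show ?thesis using Tile Yellow r by (simp add: Domain_tree_intervals)
    qed
  qed
  then show ?thesis unfolding tile_shapes_def by blast
qed

lemma periodic_tiling:
  "periodic N A \<Longrightarrow> interval_tiling n (tree_intervals T ch) (N, tiles N A)"
  unfolding interval_tiling_def
  using tiles_cylinder_tiling tiles_shapes tiles_t1 tiles_t2 by blast

text \<open>
  An element of \<open>A\<close> is the part in column 0 of a black tile, whose branch and offset identify it.
\<close>

lemma tiles_inj:
  assumes "periodic N A" "periodic N B" "tiles N A = tiles N B"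
  shows "A \<subseteq> B"
proof
  fix x assume x: "x \<in> A"
  have T: "x \<in> T" using antichain_sub assms(1) x unfolding periodic_def by blast
  have N: "0 < N" using assms periodic_pos by blast
  have "Tile Black (L x) (first_column N 0 (pos x)) (\<beta> (L x)) \<in> tiles N B"
    using elt_on_tile[OF assms(1), of x 0] x assms(3) by simp
  then have "elt (L x) 0 \<in> (\<rho> ^^ first_column N 0 (pos x)) B"
    using bottom_in_tiles_iff[OF assms(2) branch_length_pos[OF T]] by blast
  then show "x \<in> B"
    using elt_along_tile[OF assms(2) pos_bound[OF T] first_column_add[OF N, of 0]] elt_pos[OF T] by simp
qed

lemma shift_tiles:
  assumes "periodic N A"
  shows "shift k (N, tiles N ((\<rho> ^^ k) A)) = (N, tiles N A)"
proof -
  have N: "0 < N" using assms periodic_pos by blast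
  let ?f = "\<lambda>t. Tile (colour t) (rows t) ((start t + k) mod N) (width t)"
  have add: "(\<rho> ^^ s) ((\<rho> ^^ k) A) = (\<rho> ^^ ((s + k) mod N)) A" for s
    using periodic_mod[OF assms] by (simp add: funpow_add)
  have iff: "Tile c R s w \<in> tiles N ((\<rho> ^^ k) A) \<longleftrightarrow> Tile c R ((s + k) mod N) w \<in> tiles N A"
    if "s < N" for c R s w
    using that N by (cases c) (simp_all add: Black_in_tiles_iff Yellow_in_tiles_iff add)
  have "?f ` tiles N ((\<rho> ^^ k) A) = tiles N A"
  proof (intro equalityI subsetI)
    fix t assume "t \<in> ?f ` tiles N ((\<rho> ^^ k) A)"
    then obtain v where v: "v \<in> tiles N ((\<rho> ^^ k) A)" "t = ?f v" by (rule imageE)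
    obtain c R s w where "v = Tile c R s w" by (cases v)
    then have u: "Tile c R s w \<in> tiles N ((\<rho> ^^ k) A)" "t = Tile c R ((s + k) mod N) w"
      using v by auto
    have "s < N" using u(1) by (cases c) (auto simp: Black_in_tiles_iff Yellow_in_tiles_iff)
    then show "t \<in> tiles N A" using iff u by blast
  next
    fix t assume t: "t \<in> tiles N A"
    obtain c R s w where u: "t = Tile c R s w" by (cases t)
    have s: "s < N" using t u by (cases c) (auto simp: Black_in_tiles_iff Yellow_in_tiles_iff)
    then have e: "(first_column N s k + k) mod N = s" using first_column_add[OF N, of s k] by simp
    then have "Tile c R (first_column N s k) w \<in> tiles N ((\<rho> ^^ k) A)"
      using iff[OF first_column_less[OF N]] t u by simp
    then show "t \<in> ?f ` tiles N ((\<rho> ^^ k) A)" using u e by (intro image_eqI) auto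
  qed
  then show ?thesis by (simp add: shift_def)
qed

end

section \<open>Every tiling comes from a periodic rowmotion sequence\<close>

text \<open>
  The reverse direction: a tiling is read column by column as a sequence of antichains.
\<close>

locale tiled_cylinder = plane_tree T ch for T :: "'a::order set" and ch +
  fixes N :: nat and S :: "tile set"
  assumes tiling: "interval_tiling (card (leaves T)) (tree_intervals T ch) (N, S)"
begin

definition column :: "nat \<Rightarrow> 'a set" where
  "column c = {elt I j | I s w j. Tile Black I s w \<in> S \<and> j < w \<and> (s + j) mod N = c mod N}"

lemma N_pos: "0 < N"
  and tile_bounds: "t \<in> S \<Longrightarrow> rows t \<subseteq> {1..n} \<and> start t < N \<and> width t \<le> N"
  and tile_unique: "r \<in> {1..n} \<Longrightarrow> c < N \<Longrightarrow> \<exists>!t. t \<in> S \<and> tile_covers N t r c"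
  using tiling unfolding interval_tiling_def cylinder_tiling_def by auto

lemma two_tiles_equal:
  assumes "r \<in> {1..n}" "c < N" "t \<in> S" "tile_covers N t r c" "u \<in> S" "tile_covers N u r c"
  shows "t = u"
  using tile_unique[OF assms(1,2)] assms(3-) by blast

lemma Black_shape:
  assumes "Tile Black I s w \<in> S"
  shows "I \<in> L ` T" "w = \<beta> I" "s < N" "w \<le> N" "0 < w"
proof -
  have "(I, w) \<in> tree_intervals T ch"
    using tiling assms unfolding interval_tiling_def tile_shapes_def by fastforce
  then show I: "I \<in> L ` T" "w = \<beta> I" by (auto simp: tree_intervals_iff)
  show "s < N" "w \<le> N" using tile_bounds[OF assms] by auto
  show "0 < w" using I branch_length_pos by auto
qed

lemma Yellow_shape:
  assumes "Tile Yellow R s w \<in> S"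
  shows "card R = 1" "w = 1" "s < N"
proof -
  have "card R = 1 \<and> w = 1" using tiling assms unfolding interval_tiling_def tile_shapes_def by fastforce
  then show "card R = 1" "w = 1" by auto
  show "s < N" using tile_bounds[OF assms] by auto
qed

lemma column_mod: "column (c mod N) = column c"
  unfolding column_def by simp

lemma in_columnI:
  assumes "Tile Black I s w \<in> S" "j < w" "(s + j) mod N = c mod N"
  shows "elt I j \<in> column c"
  using assms unfolding column_def by blast

lemma in_columnE:
  assumes "x \<in> column c"
  obtains s where "Tile Black (L x) s (\<beta> (L x)) \<in> S" "pos x < \<beta> (L x)" "(s + pos x) mod N = c mod N"
    "x \<in> T"
proof -
  obtain I s w j where t: "x = elt I j" "Tile Black I s w \<in> S" "j < w" "(s + j) mod N = c mod N"
    using assms unfolding column_def by blast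
  have "w = \<beta> I" using Black_shape t by blast
  moreover from this have "x \<in> T" "L x = I" "pos x = j" using elt_exists[of j I] t by auto
  ultimately show ?thesis using t that by blast
qed

lemma tile_covers_column:
  assumes "x \<in> column c" "c < N" "r \<in> L x"
  obtains s where "Tile Black (L x) s (\<beta> (L x)) \<in> S" "(s + pos x) mod N = c"
    "tile_covers N (Tile Black (L x) s (\<beta> (L x))) r c"
proof -
  obtain s where s: "Tile Black (L x) s (\<beta> (L x)) \<in> S" "pos x < \<beta> (L x)"
    "(s + pos x) mod N = c mod N" using in_columnE assms(1) by blast
  have "(s + pos x) mod N = c" using s(3) assms(2) by simp
  moreover from this have "tile_covers N (Tile Black (L x) s (\<beta> (L x))) r c"
    unfolding tile_covers_def using s(2) assms(3) by auto
  ultimately show ?thesis using s(1) that by blast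
qed

text \<open>
  Two elements of a column with a common row are on the same black tile. As this tile does not wrap
  around onto itself, its offset in the column is unique, so the elements agree.
\<close>

lemma column_unique:
  assumes "x \<in> column c" "y \<in> column c" "r \<in> L x" "r \<in> L y"
  shows "x = y"
proof -
  let ?c = "c mod N"
  have c: "?c < N" using N_pos by simp
  have xy: "x \<in> column ?c" "y \<in> column ?c" using assms column_mod by auto
  have r: "r \<in> {1..n}" using interval_bounded assms(3) by blast
  obtain s where s: "Tile Black (L x) s (\<beta> (L x)) \<in> S" "(s + pos x) mod N = ?c"
    "tile_covers N (Tile Black (L x) s (\<beta> (L x))) r ?c"
    by (rule tile_covers_column[OF xy(1) c assms(3)])
  obtain s' where s': "Tile Black (L y) s' (\<beta> (L y)) \<in> S" "(s' + pos y) mod N = ?c"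
    "tile_covers N (Tile Black (L y) s' (\<beta> (L y))) r ?c"
    by (rule tile_covers_column[OF xy(2) c assms(4)])
  have eq: "L x = L y" "s = s'" using two_tiles_equal[OF r c s(1,3) s'(1,3)] by auto
  have T: "x \<in> T" "y \<in> T" using in_columnE assms by blast+
  have lt: "pos x < N" "pos y < N" using pos_bound T Black_shape(4)[OF s(1)] Black_shape(4)[OF s'(1)] by fastforce+
  have fc: "p = first_column N ?c s" if "p < N" "(s + p) mod N = ?c" for p
    using add_mod_eq_iff_first_column[OF N_pos that(1) c, of s] that(2) by (simp add: add.commute[of p s])
  have "pos x = pos y" using fc[OF lt(1) s(2)] fc[OF lt(2)] s'(2) eq(2) by simp
  then show ?thesis using pos_inj[OF T eq(1)] by simp
qed

lemma column_antichain: "column c \<in> antichains T"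
proof -
  have T: "x \<in> T" if "x \<in> column c" for x using in_columnE that by blast
  have "\<not> x < y" if "x \<in> column c" "y \<in> column c" for x y
  proof
    assume "x < y"
    moreover obtain r where "r \<in> L y" using interval_nonempty T \<open>y \<in> column c\<close> by blast
    moreover have "L y \<subseteq> L x" using \<open>x < y\<close> by (intro interval_antimono) simp
    ultimately show False using column_unique[OF that, of r] by auto
  qed
  then show ?thesis using T unfolding antichains_def by blast
qed

lemma Yellow_covers:
  assumes "Tile Yellow {r} c 1 \<in> S"
  shows "tile_covers N (Tile Yellow {r} c 1) r c"
  using Yellow_shape[OF assms] by (simp add: tile_covers_def)

lemma Yellow_iff_free:
  assumes "r \<in> {1..n}" "c < N"
  shows "Tile Yellow {r} c 1 \<in> S \<longleftrightarrow> r \<in> free_rows (column c)"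
proof
  assume Y: "Tile Yellow {r} c 1 \<in> S"
  have "r \<notin> L x" if x: "x \<in> column c" for x
  proof
    assume "r \<in> L x"
    then obtain s where "Tile Black (L x) s (\<beta> (L x)) \<in> S"
      "tile_covers N (Tile Black (L x) s (\<beta> (L x))) r c"
      using tile_covers_column[OF x assms(2)] by blast
    then show False using two_tiles_equal[OF assms Y Yellow_covers[OF Y]] by blast
  qed
  then show "r \<in> free_rows (column c)" using assms(1) unfolding free_rows_def by blast
next
  assume free: "r \<in> free_rows (column c)"
  obtain t where t: "t \<in> S" "tile_covers N t r c" using tile_unique[OF assms] by blast
  obtain k R s w where u: "t = Tile k R s w" by (cases t)
  obtain j where j: "r \<in> R" "j < w" "c = (s + j) mod N" using t(2) u by (auto simp: tile_covers_def)
  show "Tile Yellow {r} c 1 \<in> S"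
  proof (cases k)
    case Black
    then have B: "Tile Black R s w \<in> S" using t u by simp
    then have "elt R j \<in> column c" using in_columnI j by simp
    moreover have "L (elt R j) = R" using Black_shape(2)[OF B] j elt_exists by simp
    ultimately have False using free j(1) unfolding free_rows_def by blast
    then show ?thesis ..
  next
    case Yellow
    then have Y: "Tile Yellow R s w \<in> S" using t u by simp
    then have "R = {r}" "w = 1" "s = c"
      using Yellow_shape[OF Y] j by (auto simp: card_1_singleton_iff)
    then show ?thesis using Y by simp
  qed
qed

lemma yellow_rows_column:
  assumes "c < N"
  shows "yellow_rows S c = free_rows (column c)"
proof -
  have "r \<in> {1..n}" if "Tile Yellow {r} c 1 \<in> S" for r using tile_bounds[OF that] by simp
  moreover have "free_rows (column c) \<subseteq> {1..n}" by (auto simp: free_rows_def)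
  ultimately show ?thesis using Yellow_iff_free[OF _ assms] unfolding yellow_rows_def by blast
qed

lemma new_tile_in_column:
  assumes "black_tiles_at S P (c mod N)" "L x \<in> P" "x \<in> T" "pos x = 0"
  shows "x \<in> column c"
proof -
  obtain w where w: "Tile Black (L x) (c mod N) w \<in> S" using assms(1,2) unfolding black_tiles_at_def by blast
  have "elt (L x) 0 \<in> column c" using in_columnI[OF w Black_shape(5)[OF w]] by simp
  then show ?thesis using elt_pos[OF assms(3)] assms(4) by simp
qed

text \<open>
  Row by row, the tiling rules agree with rowmotion: a row is either covered in the next column by a
  common element of \<open>\<rho> (column c)\<close> and \<open>column (Suc c)\<close>, or by no element of either. In an antichain
  at most one element covers a given row, so this formulation is strong enough to give equality of the
  two antichains without treating the two inclusions separately.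
\<close>

lemma row_step:
  assumes r: "r \<in> {1..n}" and c: "c < N"
  shows "(\<exists>y \<in> \<rho> (column c) \<inter> column (Suc c). r \<in> L y) \<or>
    (\<forall>y \<in> \<rho> (column c) \<union> column (Suc c). r \<notin> L y)"
proof -
  let ?A = "column c"
  obtain t where t: "t \<in> S" "tile_covers N t r c" using tile_unique[OF assms] by blast
  obtain k R s w where u: "t = Tile k R s w" by (cases t)
  obtain j where j: "r \<in> R" "j < w" "c = (s + j) mod N" using t(2) u by (auto simp: tile_covers_def)
  show ?thesis
  proof (cases "r \<in> free_rows ?A")
    case True
    have "finite (free_rows ?A)" by (simp add: free_rows_def)
    then obtain J where J: "maximal_interval_in J (free_rows ?A)" "r \<in> J"
      using ex_maximal_interval True by blast
    then have "maximal_interval_in J (yellow_rows S c)" using yellow_rows_column[OF c] by simp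
    then obtain P where P: "maximal_partition (tree_intervals T ch) J P" "black_tiles_at S P (Suc c mod N)"
      using tiling c unfolding interval_tiling_def tiling_t2_def by blast
    \<comment> \<open>A yellow box: (t2) must prescribe the intervals that rowmotion adds in \<open>J\<close>.\<close>
    have Peq: "P = new_intervals ?A J"
      by (rule maximal_partition_unique[OF P(1) maximal_partition_new_intervals[OF J(1) column_antichain]])
    obtain x where x: "x \<in> \<rho> ?A" "r \<in> L x" "L x \<subseteq> J"
      by (rule new_intervals_cover[OF J(1) column_antichain J(2)])
    have "J \<subseteq> free_rows ?A" using J(1) unfolding maximal_interval_in_def by blast
    then have "pos x = 0" using free_new_is_bottom[OF column_antichain x(1)] x(3) by blast
    moreover have "L x \<in> P" using x unfolding Peq new_intervals_def by blast
    moreover have "x \<in> T" using x(1) in_rowmotion_iff by blast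
    ultimately have "x \<in> column (Suc c)" using new_tile_in_column[OF P(2)] by blast
    then show ?thesis using x by blast
  next
    case False
    have k: "k = Black"
    proof (cases k)
      case Yellow
      then have Y: "Tile Yellow R s w \<in> S" using t u by simp
      then have "R = {r}" "w = 1" "s = c"
        using Yellow_shape[OF Y] j by (auto simp: card_1_singleton_iff)
      then show ?thesis using Y Yellow_iff_free[OF r c] False by simp
    qed
    then have B: "Tile Black R s w \<in> S" using t u by simp
    note sh = Black_shape[OF B]
    \<comment> \<open>A black box: it stands for the element \<open>?x\<close> of the column, at height \<open>j\<close> of its branch.\<close>
    let ?x = "elt R j"
    have xA: "?x \<in> ?A" using in_columnI[OF B j(2)] j(3) by simp
    have x: "?x \<in> T" "L ?x = R" "pos ?x = j" using elt_exists[of j R] j(2) sh(2) by auto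
    have next_col: "(s + Suc j) mod N = Suc c mod N" using j(3) by (simp add: mod_Suc_eq)
    show ?thesis
    proof (cases "Suc j < w")
      case True
      then have "elt R (Suc j) \<in> \<rho> ?A" using rowmotion_branch[OF column_antichain, of j R] xA sh(2) by simp
      moreover have "elt R (Suc j) \<in> column (Suc c)" by (rule in_columnI[OF B True next_col])
      moreover have "L (elt R (Suc j)) = R" using elt_exists True sh(2) by simp
      ultimately show ?thesis using j(1) by blast
    next
      case False
      then have w: "w = Suc j" using j(2) by simp
      then have top: "Suc (pos ?x) = \<beta> (L ?x)" using x sh(2) by simp
      have t1: "if card R = 1 then Tile Yellow R (Suc c mod N) 1 \<in> S
        else \<exists>P. maximal_proper_partition (tree_intervals T ch) R P \<and> black_tiles_at S P (Suc c mod N)"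
        using tiling B next_col w unfolding interval_tiling_def tiling_t1_def by fastforce
      show ?thesis
      proof (cases "card R = 1")
        case True
        then have leaf: "?x \<in> leaves T" using top_leaf_iff[OF x(1) top] x(2) by simp
        have "r \<notin> L y" if "y \<in> \<rho> ?A" for y
          using leaf_not_covered_next[OF column_antichain xA leaf that, of r] x(2) j(1) by blast
        moreover have "Tile Yellow {r} (Suc c mod N) 1 \<in> S"
          using t1 True j(1) by (auto simp: card_1_singleton_iff)
        then have "r \<in> free_rows (column (Suc c))"
          using Yellow_iff_free[OF r, of "Suc c mod N"] N_pos column_mod by simp
        then have "r \<notin> L y" if "y \<in> column (Suc c)" for y
          using that by (simp add: free_rows_def)
        ultimately show ?thesis by blast
      next
        case False
        then obtain P where P: "maximal_proper_partition (tree_intervals T ch) R P"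
          "black_tiles_at S P (Suc c mod N)" using t1 by auto
        have "?x \<notin> leaves T" using top_leaf_iff[OF x(1) top] x(2) False by simp
        then obtain d where d: "covers T ?x d" "r \<in> L d" using child_above[OF x(1), of r] x(2) j(1) by blast
        have "maximal_proper_partition (tree_intervals T ch) R (L ` {d. covers T ?x d})"
          using maximal_proper_partition_children[OF x(1) top] x(2) False by simp
        then have "P = L ` {d. covers T ?x d}" by (rule maximal_proper_partition_unique[OF P(1)])
        then have "L d \<in> P" using d(1) by blast
        moreover have "d \<in> T" using d(1) by (simp add: covers_def)
        ultimately have "d \<in> column (Suc c)"
          using new_tile_in_column[OF P(2)] child_of_top[OF top d(1)] by blast
        then show ?thesis using cover_in_rowmotion[OF column_antichain xA d(1)] d(2) by blast
      qed
    qed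
  qed
qed

lemma column_Suc: "column (Suc c) = \<rho> (column c)"
proof -
  have *: "\<rho> (column c) = column (Suc c)" if c: "c < N" for c
  proof -
    \<comment> \<open>The conclusion of \<open>row_step\<close> is symmetric in the two antichains, so one inclusion suffices.\<close>
    have sub: "A \<subseteq> B"
      if AB: "A = \<rho> (column c) \<and> B = column (Suc c) \<or> B = \<rho> (column c) \<and> A = column (Suc c)" for A B
    proof
      fix x assume x: "x \<in> A"
      have A: "A \<in> antichains T" using AB rowmotion_antichain column_antichain by blast
      have "x \<in> T" using antichain_sub A x by blast
      then obtain r where r: "r \<in> L x" using interval_nonempty by blast
      then have "r \<in> {1..n}" using interval_bounded by blast
      then obtain y where y: "y \<in> A" "y \<in> B" "r \<in> L y" using row_step[OF _ c, of r] AB x r by blast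
      then have "x = y" using antichain_unique[OF A x y(1) r] by blast
      then show "x \<in> B" using y by blast
    qed
    show ?thesis using sub by (intro equalityI) blast+
  qed
  have "\<rho> (column (c mod N)) = column (Suc (c mod N))" using * N_pos by simp
  moreover have "column (Suc (c mod N)) = column (Suc c)"
    using column_mod[of "Suc (c mod N)"] column_mod[of "Suc c"] by (simp add: mod_Suc_eq)
  ultimately show ?thesis using column_mod by simp
qed

lemma column_eq: "column c = (\<rho> ^^ c) (column 0)"
  by (induction c) (simp_all add: column_Suc)

lemma column_periodic: "periodic N (column 0)"
  unfolding periodic_def using column_antichain N_pos column_eq[of N] column_mod[of N] by simp

lemma tiles_column: "tiles N (column 0) = S"
proof (intro set_eqI)
  fix t
  obtain k R s w where t: "t = Tile k R s w" by (cases t)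
  show "t \<in> tiles N (column 0) \<longleftrightarrow> t \<in> S"
  proof (cases k)
    case Black
    have "Tile Black R s w \<in> tiles N (column 0)" if B: "Tile Black R s w \<in> S"
    proof -
      note sh = Black_shape[OF B]
      have "elt R 0 \<in> column s" using in_columnI[OF B sh(5)] by simp
      then show ?thesis using bottom_in_tiles_iff[OF column_periodic] sh column_eq[symmetric] by simp
    qed
    moreover have "Tile Black R s w \<in> S" if B: "Tile Black R s w \<in> tiles N (column 0)"
    proof -
      obtain x where x: "s < N" "w = \<beta> R" "x \<in> column s" "pos x = 0" "L x = R"
        using B unfolding Black_in_tiles_iff column_eq[symmetric] by auto
      then obtain s' where s': "Tile Black R s' w \<in> S" "(s' + 0) mod N = s mod N"
        using in_columnE[OF x(3)] by auto
      then have "s' = s" using Black_shape(3)[OF s'(1)] x(1) by simp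
      then show ?thesis using s' by simp
    qed
    ultimately show ?thesis using t Black by blast
  next
    case Yellow
    have "Tile Yellow R s w \<in> tiles N (column 0)" if Y: "Tile Yellow R s w \<in> S"
    proof -
      note sh = Yellow_shape[OF Y]
      obtain r where r: "R = {r}" using sh(1) by (auto simp: card_1_singleton_iff)
      then have "r \<in> {1..n}" using tile_bounds[OF Y] by simp
      then have "r \<in> free_rows (column s)" using Yellow_iff_free sh Y r by simp
      then show ?thesis using sh r by (simp add: Yellow_in_tiles_iff column_eq[symmetric])
    qed
    moreover have "Tile Yellow R s w \<in> S" if Y: "Tile Yellow R s w \<in> tiles N (column 0)"
    proof -
      obtain r where r: "s < N" "w = 1" "R = {r}" "r \<in> free_rows (column s)"
        using Y unfolding Yellow_in_tiles_iff column_eq[symmetric] by auto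
      then have "r \<in> {1..n}" by (simp add: free_rows_def)
      then show ?thesis using Yellow_iff_free r by simp
    qed
    ultimately show ?thesis using t Yellow by blast
  qed
qed

end

section \<open>Orbits and primitive tilings\<close>

context plane_tree
begin

lemma tiling_is_periodic:
  assumes "interval_tiling n (tree_intervals T ch) (N, S)"
  obtains A where "periodic N A" "S = tiles N A"
proof -
  interpret tiled_cylinder T ch N S by unfold_locales (rule assms)
  show ?thesis using that column_periodic tiles_column by metis
qed

lemma orbit_card_least:
  assumes "A \<in> antichains T"
  shows "periodic (card (orbit \<rho> A)) A"
    and "0 < k \<Longrightarrow> (\<rho> ^^ k) A = A \<Longrightarrow> card (orbit \<rho> A) \<le> k"
proof -
  let ?d = "funpow_dist1 \<rho> A A"
  have self: "A \<in> orbit \<rho> A" by (rule antichain_in_orbit[OF assms])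
  have card: "card (orbit \<rho> A) = ?d"
    unfolding orbit_conv_funpow_dist1[OF self] using inj_on_funpow_dist1[OF self] by (simp add: card_image)
  show "periodic (card (orbit \<rho> A)) A"
    unfolding periodic_def card using assms funpow_dist1_prop[OF self] by simp
  show "card (orbit \<rho> A) \<le> k" if "0 < k" "(\<rho> ^^ k) A = A"
    unfolding card using funpow_dist1_least[of k \<rho> A A] that by linarith
qed

text \<open>
  With \<open>bottom_appears\<close>, this shows that the black tiles of \<open>tiles\<close> are maximal runs.
\<close>

lemma top_disappears:
  assumes "A \<in> antichains T" "x \<in> A" "Suc (pos x) = \<beta> (L x)"
  shows "L x \<notin> L ` \<rho> A"
proof
  assume "L x \<in> L ` \<rho> A"
  then obtain y where y: "y \<in> \<rho> A" "L y = L x" by auto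
  have T: "x \<in> T" "y \<in> T" "y \<notin> down T A" using antichain_sub assms y in_rowmotion_iff by blast+
  then have "\<not> y \<le> x" using assms(2) unfolding down_def by blast
  then have "x < y" using branch_chain[OF T(1,2)] y(2) by auto
  then show False using above_top[OF T(1) assms(3) T(2)] y(2) by blast
qed

lemma bottom_appears:
  assumes "A \<in> antichains T" "x \<in> \<rho> A" "pos x = 0"
  shows "L x \<notin> L ` A"
proof
  assume "L x \<in> L ` A"
  then obtain y where y: "y \<in> A" "L y = L x" by auto
  have T: "x \<in> T" "y \<in> T" "x \<notin> down T A" using antichain_sub assms y in_rowmotion_iff by blast+
  then have "\<not> x \<le> y" using y(1) unfolding down_def by blast
  then have "y < x" using branch_chain[OF T(1,2)] y(2) by auto
  then show False using pos_0_iff[OF T(1)] assms(3) T(2) y(2) by blast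
qed

text \<open>
  A maximal run of the interval \<open>I\<close> begins with the bottom element of the branch, as any other element
  has its lower cover, on the same branch, in the preceding column. From then on it lasts exactly as
  long as the branch.
\<close>

lemma orbit_cylinder_tiles:
  assumes "A \<in> antichains T"
  shows "orbit_cylinder T ch A = (card (orbit \<rho> A), tiles (card (orbit \<rho> A)) A)"
proof -
  define N where "N = card (orbit \<rho> A)"
  define B where "B c = L ` ((\<rho> ^^ c) A)" for c
  have per: "periodic N A" unfolding N_def by (rule orbit_card_least(1)[OF assms])
  have N: "0 < N" by (rule periodic_pos[OF per])
  have anti: "(\<rho> ^^ c) A \<in> antichains T" for c by (rule periodic_antichain[OF per])
  have prev: "\<rho> ((\<rho> ^^ (s + N - 1)) A) = (\<rho> ^^ s) A" for s
  proof -
    have "\<rho> ((\<rho> ^^ (s + N - 1)) A) = (\<rho> ^^ (s + N)) A"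
      using N by (cases "s + N") auto
    also have "\<dots> = (\<rho> ^^ s) A" using periodic_mod[OF per, of "s + N"] periodic_mod[OF per, of s] by simp
    finally show ?thesis .
  qed
  have run: "0 < \<beta> I \<and> (\<forall>j<\<beta> I. I \<in> B (s + j)) \<and> I \<notin> B (s + N - 1) \<and> I \<notin> B (s + \<beta> I)"
    if x: "x \<in> (\<rho> ^^ s) A" "pos x = 0" "L x = I" for x s I
  proof (intro conjI allI impI)
    have T: "x \<in> T" using antichain_sub[OF anti] x by blast
    show b: "0 < \<beta> I" using branch_length_pos[OF T] x by simp
    have e0: "elt I 0 \<in> (\<rho> ^^ s) A" using elt_pos[OF T] x by simp
    have e: "elt I j \<in> (\<rho> ^^ (s + j)) A" "L (elt I j) = I" if "j < \<beta> I" for j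
      using elt_along_tile[OF per that, of s "s + j"] e0 elt_exists[OF that] by auto
    show "I \<in> B (s + j)" if "j < \<beta> I" for j unfolding B_def using e[OF that] by force
    show "I \<notin> B (s + N - 1)" unfolding B_def
      using bottom_appears[OF anti, of x "s + N - 1"] x prev by simp
    obtain j where j: "\<beta> I = Suc j" using b by (metis gr0_implies_Suc)
    have "Suc (pos (elt I j)) = \<beta> (L (elt I j))" using elt_exists[of j I] j by simp
    then show "I \<notin> B (s + \<beta> I)" unfolding B_def
      using top_disappears[OF anti e(1), of j] e(2)[of j] j by simp
  qed
  have black: "0 < w \<and> (\<forall>j<w. I \<in> B (s + j)) \<and> I \<notin> B (s + N - 1) \<and> I \<notin> B (s + w) \<longleftrightarrow>
      w = \<beta> I \<and> (\<exists>x\<in>(\<rho> ^^ s) A. pos x = 0 \<and> L x = I)" (is "?l \<longleftrightarrow> ?r") for I s w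
  proof
    assume ?r
    then show ?l using run by blast
  next
    assume l: ?l
    then have "I \<in> B s" by (metis add.right_neutral)
    then obtain x where x: "x \<in> (\<rho> ^^ s) A" "L x = I" unfolding B_def by auto
    have T: "x \<in> T" using antichain_sub[OF anti] x by blast
    have "pos x = 0"
    proof (rule ccontr)
      assume "pos x \<noteq> 0"
      then obtain j where j: "pos x = Suc j" by (cases "pos x") auto
      then have "Suc j < \<beta> I" using pos_bound[OF T] x by simp
      then have "elt I j \<in> (\<rho> ^^ (s + N - 1)) A" "L (elt I j) = I"
        using rowmotion_branch[OF anti, of j I "s + N - 1"] prev elt_pos[OF T] x j
          elt_exists[of j I] by auto
      then show False using l unfolding B_def by blast
    qed
    note r = run[OF x(1) this x(2)]
    then have "\<not> w < \<beta> I" "\<not> \<beta> I < w" using l by blast+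
    then show ?r using x \<open>pos x = 0\<close> by auto
  qed
  have yellow: "r \<in> {1..n} \<and> r \<notin> \<Union> (B s) \<longleftrightarrow> r \<in> free_rows ((\<rho> ^^ s) A)" for r s
    unfolding B_def free_rows_def by blast
  have "orbit_cylinder T ch A = (N,
      {Tile Black I s w | I s w. s < N \<and> (0 < w \<and> (\<forall>j<w. I \<in> B (s + j)) \<and> I \<notin> B (s + N - 1) \<and> I \<notin> B (s + w))} \<union>
      {Tile Yellow {r} s 1 | r s. s < N \<and> (r \<in> {1..n} \<and> r \<notin> \<Union> (B s))})"
    unfolding orbit_cylinder_def Let_def black_intervals_def N_def B_def by simp
  also have "\<dots> = (N, tiles N A)"
    unfolding black yellow tiles_def by blast
  finally show ?thesis unfolding N_def .
qed

text \<open>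
  Rotating the cylinder by \<open>k\<close> columns amounts to \<open>k\<close> backward steps of rowmotion, that is, to
  \<open>N k - k\<close> forward steps.
\<close>

lemma shift_periodic:
  assumes "periodic N A"
  obtains B where "periodic N B" "(\<rho> ^^ k) B = A" "shift k (N, tiles N A) = (N, tiles N B)"
    "B \<in> orbit \<rho> A"
proof -
  have N: "0 < N" by (rule periodic_pos[OF assms])
  let ?m = "N * k - k"
  define B where "B = (\<rho> ^^ ?m) A"
  have "k + ?m = N * k" using N by simp
  then have BA: "(\<rho> ^^ k) B = A"
    using periodic_mod[OF assms, of "N * k"] unfolding B_def
    by (metis comp_apply funpow_add funpow_0 mod_mult_self1_is_0)
  have "(\<rho> ^^ N) B = (\<rho> ^^ ?m) ((\<rho> ^^ N) A)"
    unfolding B_def by (metis add.commute comp_apply funpow_add)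
  then have per: "periodic N B" using assms periodic_antichain[OF assms] unfolding periodic_def B_def by simp
  have "A \<in> orbit \<rho> A" using assms antichain_in_orbit unfolding periodic_def by blast
  then have "B \<in> orbit \<rho> A" unfolding B_def by (rule funpow_in_orbit)
  then show ?thesis using that[OF per BA] shift_tiles[OF per, of k] BA by simp
qed

text \<open>
  A rotation fixes the picture if and only if the corresponding power of rowmotion fixes \<open>A\<close>, since
  the picture determines \<open>A\<close>.
\<close>

lemma primitive_iff:
  assumes "periodic N A"
  shows "primitive (N, tiles N A) \<longleftrightarrow> N = card (orbit \<rho> A)"
proof -
  have anti: "A \<in> antichains T" using assms by (simp add: periodic_def)
  let ?d = "card (orbit \<rho> A)"
  have d: "periodic ?d A" by (rule orbit_card_least(1)[OF anti])
  have dN: "?d \<le> N" using orbit_card_least(2)[OF anti, of N] assms by (simp add: periodic_def)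
  show ?thesis
  proof
    assume p: "primitive (N, tiles N A)"
    have "shift ?d (N, tiles N A) = (N, tiles N A)"
      using shift_tiles[OF assms, of ?d] d by (simp add: periodic_def)
    then show "N = ?d" using p dN periodic_pos[OF d] unfolding primitive_def by force
  next
    assume N: "N = ?d"
    show "primitive (N, tiles N A)" unfolding primitive_def
    proof (intro allI impI notI)
      fix k assume k: "0 < k \<and> k < fst (N, tiles N A)" and eq: "shift k (N, tiles N A) = (N, tiles N A)"
      obtain B where B: "periodic N B" "(\<rho> ^^ k) B = A" "shift k (N, tiles N A) = (N, tiles N B)"
        using shift_periodic[OF assms] by blast
      then have "A = B" using eq tiles_inj[OF assms B(1)] tiles_inj[OF B(1) assms] by auto
      then show False using orbit_card_least(2)[OF anti, of k] B(2) k N by auto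
    qed
  qed
qed

lemma orbit_antichain: "A \<in> antichains T \<Longrightarrow> B \<in> orbit \<rho> A \<Longrightarrow> B \<in> antichains T"
  unfolding orbit_altdef using rowmotion_pow_antichain by blast

lemma orbit_eq: "A \<in> antichains T \<Longrightarrow> B \<in> orbit \<rho> A \<Longrightarrow> orbit \<rho> B = orbit \<rho> A"
  using antichain_in_orbit by (auto intro: orbit_trans orbit_swap)

lemma tau_orbit:
  assumes "A \<in> antichains T"
  shows "tau T ch (orbit \<rho> A) = (\<lambda>B. (card (orbit \<rho> A), tiles (card (orbit \<rho> A)) B)) ` orbit \<rho> A"
  unfolding tau_def using orbit_cylinder_tiles orbit_antichain[OF assms] orbit_eq[OF assms]
  by (intro image_cong) auto

lemma tau_class:
  assumes "A \<in> antichains T"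
  shows "tau T ch (orbit \<rho> A) = rotation_rel `` {(card (orbit \<rho> A), tiles (card (orbit \<rho> A)) A)}"
proof -
  let ?N = "card (orbit \<rho> A)"
  have per: "periodic ?N A" by (rule orbit_card_least(1)[OF assms])
  have "\<exists>k. (?N, tiles ?N B) = shift k (?N, tiles ?N A)" if B: "B \<in> orbit \<rho> A" for B
  proof -
    have B': "B \<in> antichains T" "orbit \<rho> B = orbit \<rho> A"
      using orbit_antichain orbit_eq assms B by blast+
    then have perB: "periodic ?N B" using orbit_card_least(1)[OF B'(1)] by simp
    have "A \<in> orbit \<rho> B" using antichain_in_orbit[OF assms] B' by simp
    then obtain k where "A = (\<rho> ^^ k) B" unfolding orbit_altdef by blast
    then show ?thesis using shift_tiles[OF perB, of k] by metis
  qed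
  moreover have "shift k (?N, tiles ?N A) \<in> (\<lambda>B. (?N, tiles ?N B)) ` orbit \<rho> A" for k
    using shift_periodic[OF per, of k] by (metis imageI)
  ultimately show ?thesis unfolding tau_orbit[OF assms] rotation_rel_def by blast
qed

lemma tau_bij:
  "bij_betw (tau T ch) (rowmotion_orbits T) (interval_tilings n (tree_intervals T ch))"
  unfolding bij_betw_def
proof
  show "inj_on (tau T ch) (rowmotion_orbits T)"
  proof (rule inj_onI)
    fix O1 O2 assume "O1 \<in> rowmotion_orbits T" "O2 \<in> rowmotion_orbits T" and eq: "tau T ch O1 = tau T ch O2"
    then obtain A B where AB: "A \<in> antichains T" "O1 = orbit \<rho> A" "B \<in> antichains T" "O2 = orbit \<rho> B"
      unfolding rowmotion_orbits_def by blast
    have "(card O1, tiles (card O1) A) \<in> tau T ch O1"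
      unfolding AB(2) tau_orbit[OF AB(1)] using antichain_in_orbit[OF AB(1)] by blast
    then have "(card O1, tiles (card O1) A) \<in> tau T ch O2" using eq by simp
    then obtain C where C: "C \<in> O2" "card O1 = card O2" "tiles (card O1) A = tiles (card O2) C"
      unfolding AB(4) tau_orbit[OF AB(3)] by auto
    have C': "C \<in> antichains T" "orbit \<rho> C = O2" using orbit_antichain orbit_eq C(1) AB by blast+
    have "periodic (card O1) A" "periodic (card O1) C"
      using orbit_card_least(1)[OF AB(1)] orbit_card_least(1)[OF C'(1)] C'(2) C(2) AB(2) by auto
    then have "A = C" using tiles_inj C by (metis subset_antisym)
    then show "O1 = O2" using C' AB(2) by simp
  qed
  show "tau T ch ` rowmotion_orbits T = interval_tilings n (tree_intervals T ch)"
  proof (intro equalityI subsetI)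
    fix X assume "X \<in> tau T ch ` rowmotion_orbits T"
    then obtain A where A: "A \<in> antichains T" "X = tau T ch (orbit \<rho> A)"
      unfolding rowmotion_orbits_def by blast
    have "periodic (card (orbit \<rho> A)) A" by (rule orbit_card_least(1)[OF A(1)])
    then show "X \<in> interval_tilings n (tree_intervals T ch)"
      unfolding interval_tilings_def A(2) tau_class[OF A(1)]
      using periodic_tiling primitive_iff by (intro quotientI) simp
  next
    fix X assume "X \<in> interval_tilings n (tree_intervals T ch)"
    then obtain C where C: "interval_tiling n (tree_intervals T ch) C" "primitive C" "X = rotation_rel `` {C}"
      unfolding interval_tilings_def quotient_def by blast
    obtain N S where NS: "C = (N, S)" by (cases C)
    obtain A where A: "periodic N A" "S = tiles N A" using tiling_is_periodic C(1) NS by blast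
    then have N: "N = card (orbit \<rho> A)" using primitive_iff C(2) NS by blast
    have anti: "A \<in> antichains T" using A(1) by (simp add: periodic_def)
    have "X = tau T ch (orbit \<rho> A)" unfolding C(3) NS A(2) tau_class[OF anti] N[symmetric] ..
    then show "X \<in> tau T ch ` rowmotion_orbits T" unfolding rowmotion_orbits_def using anti by blast
  qed
qed

end

theorem theorem2p2:
  fixes T :: "'a::order set" and ch :: "'a \<Rightarrow> 'a list"
  assumes "rooted_tree T" and "plane_embedding T ch"
  shows "bij_betw (tau T ch) (rowmotion_orbits T)
           (interval_tilings (card (leaves T)) (tree_intervals T ch))"
proof -
  interpret plane_tree T ch by unfold_locales (rule assms)+
  show ?thesis by (rule tau_bij)
qed

end
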